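(* Let $(X,\mathcal{S}(X),\mu)$ be a standard probability space equipped with a measurable metric $d$. Suppose $(X,d)$ is compact and $\mu$ is nonatomic. Let $T$ be a continuous, ergodic, measure-preserving transformation on $X$, let $h_\mu(T)$ be its metric (measure-theoretic) entropy, and let $a>0$. If $h_\mu(T)>\frac{1}{a}$, then $T$ is restricted sensitive with asymptotic rate $a$ (the same $a$ at every point); that is, for $\mu$-a.e. $x\in X$ there exists $\delta>0$ such that for every $\varepsilon>0$ there exists an integer $n\ge 0$ with $n\le -a\log\mu(B_\varepsilon(x))$ and $$\mu\{y\in B_\varepsilon(x): d(T^nx,T^ny)>\delta\}>0.$$
   Context: The metric $d$ is assumed measurable, so that $d$-balls are measurable. $B_r(x)=\{y: d(x,y)<r\}$ is the open ball. $\log$ is the natural logarithm (also in the definition of entropy), with $-\log 0=+\infty$. In general, a measurable nonsingular transformation $T$ is called restricted sensitive if for $\mu$-a.e. $x\in X$ there exist $\delta>0$ and $a>0$ (a sensitivity constant and an asymptotic rate at $x$, possibly depending on $x$) such that for every $\varepsilon>0$ there is an integer $0\le n\le -a\log\mu(B_\varepsilon(x))$ with $\mu\{y\in B_\varepsilon(x): d(T^nx,T^ny)>\delta\}>0$. *)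

theory Defs
  imports "HOL-Probability.Probability"
begin

section \<open>Standard probability spaces\<close>

definition polish_topology :: "'a topology \<Rightarrow> bool" where
  "polish_topology S \<longleftrightarrow> completely_metrizable_space S \<and> second_countable S"

definition standard_borel :: "'a measure \<Rightarrow> bool" where
  "standard_borel M \<longleftrightarrow>
     (\<exists>S. polish_topology S \<and> topspace S = space M \<and>
          sets M = sigma_sets (space M) {U. openin S U})"

text \<open>
  Both usages of the term are covered: a probability measure on a standard Borel space, and the
  completion of such a measure (a Lebesgue space).
\<close>

definition standard_prob_space :: "'a measure \<Rightarrow> bool" where
  "standard_prob_space M \<longleftrightarrow>
     prob_space M \<and> (standard_borel M \<or> (\<exists>N. standard_borel N \<and> M = completion N))"

definition nonatomic :: "'a measure \<Rightarrow> bool" where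
  "nonatomic M \<longleftrightarrow>
     (\<forall>A\<in>sets M. 0 < emeasure M A \<longrightarrow>
        (\<exists>B\<in>sets M. B \<subseteq> A \<and> 0 < emeasure M B \<and> emeasure M B < emeasure M A))"


section \<open>Measure-preserving and ergodic maps\<close>

definition measure_preserving :: "'a measure \<Rightarrow> ('a \<Rightarrow> 'a) \<Rightarrow> bool" where
  "measure_preserving M T \<longleftrightarrow>
     T \<in> measurable M M \<and>
     (\<forall>A\<in>sets M. emeasure M (T -` A \<inter> space M) = emeasure M A)"

definition ergodic :: "'a measure \<Rightarrow> ('a \<Rightarrow> 'a) \<Rightarrow> bool" where
  "ergodic M T \<longleftrightarrow>
     (\<forall>A\<in>sets M. T -` A \<inter> space M = A \<longrightarrow>
        emeasure M A = 0 \<or> emeasure M (space M - A) = 0)"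


section \<open>Measure-theoretic entropy\<close>

definition finite_partition :: "'a measure \<Rightarrow> 'a set set \<Rightarrow> bool" where
  "finite_partition M P \<longleftrightarrow> finite P \<and> P \<subseteq> sets M \<and> partition_on (space M) P"

text \<open>
  The convention \<open>0 * ln 0 = 0\<close> holds automatically. In particular the empty set, which may
  occur in the refinements below, does not contribute.
\<close>

definition partition_entropy :: "'a measure \<Rightarrow> 'a set set \<Rightarrow> real" where
  "partition_entropy M P = (\<Sum>A\<in>P. - (measure M A * ln (measure M A)))"

text \<open>
  The join of the partitions \<open>T\<^sup>-\<^sup>i P\<close> for \<open>i < n\<close>; two different choices of cells give
  disjoint intersections, so they give the same set only if it is empty.
\<close>

definition refinement :: "'a measure \<Rightarrow> ('a \<Rightarrow> 'a) \<Rightarrow> 'a set set \<Rightarrow> nat \<Rightarrow> 'a set set" where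
  "refinement M T P n = {space M \<inter> (\<Inter>i<n. (T ^^ i) -` A i) | A. \<forall>i<n. A i \<in> P}"

definition entropy_wrt :: "'a measure \<Rightarrow> ('a \<Rightarrow> 'a) \<Rightarrow> 'a set set \<Rightarrow> real" where
  "entropy_wrt M T P = lim (\<lambda>n. partition_entropy M (refinement M T P n) / real n)"

definition metric_entropy :: "'a measure \<Rightarrow> ('a \<Rightarrow> 'a) \<Rightarrow> ereal" where
  "metric_entropy M T = (SUP P\<in>{P. finite_partition M P}. ereal (entropy_wrt M T P))"


section \<open>Restricted sensitivity\<close>

text \<open>The convention \<open>- log 0 = \<infinity>\<close> has to be made explicit, since \<open>ln 0 = 0\<close>.\<close>

definition neg_log :: "real \<Rightarrow> ereal" where
  "neg_log p = (if p = 0 then \<infinity> else ereal (- ln p))"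

definition restricted_sensitive_at ::
    "'a measure \<Rightarrow> ('a \<Rightarrow> 'a \<Rightarrow> real) \<Rightarrow> ('a \<Rightarrow> 'a) \<Rightarrow> real \<Rightarrow> real \<Rightarrow> 'a \<Rightarrow> bool" where
  "restricted_sensitive_at M d T \<delta> a x \<longleftrightarrow>
     (\<forall>\<epsilon>>0. \<exists>n::nat.
        ereal (real n) \<le> ereal a * neg_log (measure M (Metric_space.mball (space M) d x \<epsilon>)) \<and>
        0 < measure M {y \<in> Metric_space.mball (space M) d x \<epsilon>. \<delta> < d ((T ^^ n) x) ((T ^^ n) y)})"

text \<open>
  In plain restricted sensitivity the rate \<open>a\<close> may depend on the point; here it is the same at
  almost every point, while the sensitivity constant \<open>\<delta>\<close> may vary.
\<close>

definition restricted_sensitive_with_rate ::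
    "'a measure \<Rightarrow> ('a \<Rightarrow> 'a \<Rightarrow> real) \<Rightarrow> ('a \<Rightarrow> 'a) \<Rightarrow> real \<Rightarrow> bool" where
  "restricted_sensitive_with_rate M d T a \<longleftrightarrow>
     (AE x in M. \<exists>\<delta>>0. restricted_sensitive_at M d T \<delta> a x)"

end

theory Submission
  imports Defs
begin

text \<open>
  Why the theorem holds. Write \<open>B\<^sub>n(x,\<delta>)\<close> for the Bowen ball of the points whose orbit stays
  \<open>\<delta>\<close>-close to that of \<open>x\<close> for \<open>n\<close> steps. Almost every point lies in the support of \<open>\<mu>\<close>; let \<open>x\<close> be such
  a point. If \<open>x\<close> is not sensitive with constant \<open>\<delta>\<close> and rate \<open>a\<close>, then some ball \<open>B\<^sub>\<epsilon>(x)\<close> lies, up to a null set, in \<open>B\<^sub>n(x,\<delta>)\<close> for the least integer \<open>n\<close> above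
  \<open>- a ln \<mu>(B\<^sub>\<epsilon>(x))\<close>, so that \<open>\<mu>(B\<^sub>n(x,\<delta>)) \<ge> exp (- n / a)\<close>. As \<open>\<mu>\<close> has no atoms, \<open>n\<close> tends to infinity
  when \<open>\<delta>\<close> tends to 0. Hence, if \<open>x\<close> is sensitive for no \<open>\<delta>\<close>, its Bowen balls of arbitrarily
  small radius decay, along some sequence of times, at most at the exponential rate \<open>1 / a\<close>
  (\<open>insensitive_imp_slow_decay\<close>). The set of points with this slow decay is mapped into itself by
  \<open>T\<close>, so by ergodicity it is null or conull. If it were conull, the entropy would be at most
  \<open>1 / a\<close> (\<open>entropy_wrt_le_slow_decay_rate\<close>), against the hypothesis.

  The last implication is one half of the Brin-Katok theorem, and the proof is by coding. By the Gibbs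
  inequality the entropy of the \<open>N\<close>-step itineraries for a partition is at most the mean of \<open>- ln q\<close>
  over itineraries, for every subprobability \<open>q\<close> on words. To build a good \<open>q\<close>, cut a word into blocks and
  give each block of length \<open>n\<close> a weight; multiply weights of blocks and sum over all ways to cut.
  The weight of a block \<open>w\<close> is essentially the \<open>\<mu>\<close>-average over \<open>x\<close> of the probability to see \<open>w\<close> when
  the itinerary of \<open>x\<close> is transmitted through a noisy channel that allows for errors of size \<open>\<delta>\<close>.
  An itinerary of a point \<open>y\<close> then receives at least the weight \<open>\<mu>(B\<^sub>n(y,\<delta>))\<close>, up to factors
  \<open>exp (- \<eta> n)\<close>. So as long as an orbit visits points with slow decay, blocks of cost about \<open>n / a\<close>
  are available; other times are coded letter by letter, and they are rare in the mean because
  the other points form a set of small measure and \<open>\<mu>\<close> is invariant.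

  The channel needs disjoint neighbourhoods of compact sets that fill the cells of the partition up
  to small measure. Cells are measurable for the standard structure, while compactness refers to
  \<open>d\<close>; both are related by a Lusin argument (\<open>standard_prob_space_inner_regular_wrt_measurable_topology\<close>).
\<close>

section \<open>Inner regularity of standard probability spaces\<close>

lemma closedin_measurable:
  assumes "topspace S = space M" and "\<And>U. openin S U \<Longrightarrow> U \<in> sets M" and "closedin S F"
  shows "F \<in> sets M"
  using assms(2)[of "space M - F"] assms(1,3)
  by (metis closedin_def double_diff sets.compl_sets subset_refl)

lemma (in finite_measure) union_of_small_sets_small:
  fixes B :: "nat \<Rightarrow> 'a set"
  assumes B: "\<And>i. B i \<in> sets M" "\<And>i. measure M (B i) < e / 2 ^ (i + 2)" and e: "0 < e"
  shows "measure M (\<Union>i. B i) < e"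
proof -
  have s: "(\<lambda>i. e / 2 ^ (i + 2)) sums (e / 2)"
    using sums_mult[OF power_half_series, of "e / 2"] by (simp add: field_simps power_divide)
  have sm: "summable (\<lambda>i. measure M (B i))"
    by (rule summable_comparison_test'[OF sums_summable[OF s], of 0])
      (use B(2) in \<open>auto intro: less_imp_le\<close>)
  have "measure M (\<Union>i. B i) \<le> (\<Sum>i. measure M (B i))"
    by (rule finite_measure_subadditive_countably) (use B sm in auto)
  also have "\<dots> \<le> e / 2"
    unfolding sums_unique[OF s]
    by (rule suminf_le[OF _ sm sums_summable[OF s]]) (use B(2) in \<open>auto intro: less_imp_le\<close>)
  finally show ?thesis using e by simp
qed

text \<open>
  The sets that are approximated by closed sets from inside and by open sets from outside form a
  \<open>\<sigma>\<close>-algebra; it contains the open sets because these are \<open>F\<^sub>\<sigma>\<close> in a metrizable space. Asking for both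
  approximations at once is what makes the class closed under complements.
\<close>

lemma (in finite_measure) metrizable_borel_regular:
  assumes met: "metrizable_space S" and top: "topspace S = space M"
    and gen: "sets M = sigma_sets (space M) {U. openin S U}"
    and A: "A \<in> sets M" and e: "0 < e"
  shows "\<exists>F U. closedin S F \<and> openin S U \<and> F \<subseteq> A \<and> A \<subseteq> U \<and> measure M (U - F) < e"
proof -
  have op[measurable]: "U \<in> sets M" if "openin S U" for U
    using that gen by (auto intro: sigma_sets.Basic)
  have cl[measurable]: "F \<in> sets M" if "closedin S F" for F
    by (rule closedin_measurable[OF top op that])
  have "A \<in> sigma_sets (space M) {U. openin S U}" using A gen by simp
  then show ?thesis using e
  proof (induction arbitrary: e rule: sigma_sets.induct)
    case (Basic A)
    then have oA: "openin S A" by simp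
    then obtain C where C: "\<And>n. closedin S (C n)" "\<And>n. C n \<subseteq> C (Suc n)" "(\<Union>n. C n) = A"
      using open_imp_fsigma_in[OF met, of A] unfolding fsigma_in_ascending by auto
    have "(\<lambda>n. measure M (A - C n)) \<longlonglongrightarrow> measure M (\<Inter>n. A - C n)"
      using C oA by (intro finite_Lim_measure_decseq) (auto intro!: decseq_SucI)
    also have "(\<Inter>n. A - C n) = {}" using C(3) by auto
    finally have "eventually (\<lambda>n. measure M (A - C n) < e) sequentially"
      using \<open>0 < e\<close> by (intro order_tendstoD) auto
    then obtain n where "measure M (A - C n) < e" by (auto simp: eventually_sequentially)
    then show ?case using C oA by - (rule exI[of _ "C n"], rule exI[of _ A], auto)
  next
    case Empty
    then show ?case by (intro exI[of _ "{}"]) auto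
  next
    case (Compl A)
    obtain F U where FU: "closedin S F" "openin S U" "F \<subseteq> A" "A \<subseteq> U" "measure M (U - F) < e"
      using Compl.IH[OF Compl.prems] by blast
    have "U \<subseteq> space M" using FU(2) top openin_subset by metis
    then have "(space M - F) - (space M - U) = U - F" by auto
    then show ?case
      using FU top \<open>U \<subseteq> space M\<close>
      by - (rule exI[of _ "space M - U"], rule exI[of _ "space M - F"],
          auto simp: closedin_def double_diff)
  next
    case (Union A)
    have "\<forall>i. \<exists>F U. closedin S F \<and> openin S U \<and> F \<subseteq> A i \<and> A i \<subseteq> U
        \<and> measure M (U - F) < e / 2 ^ (i + 2)"
      using Union.IH Union.prems by auto
    then obtain F U where FU: "\<And>i. closedin S (F i)" "\<And>i. openin S (U i)" "\<And>i. F i \<subseteq> A i"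
        "\<And>i. A i \<subseteq> U i" "\<And>i. measure M (U i - F i) < e / 2 ^ (i + 2)"
      by metis
    note [measurable] = op[OF FU(2)] cl[OF FU(1)]
    \<comment> \<open>The union of all \<open>F i\<close> need not be closed; by continuity of the measure finitely many suffice.\<close>
    let ?D = "\<lambda>k. (\<Union>i. U i) - (\<Union>i\<le>k. F i)"
    have lim: "(\<lambda>k. measure M (?D k)) \<longlonglongrightarrow> measure M (\<Inter>k. ?D k)"
      by (intro finite_Lim_measure_decseq) (auto simp: decseq_def)
    have "measure M (\<Inter>k. ?D k) \<le> measure M (\<Union>i. U i - F i)"
      by (intro finite_measure_mono) auto
    also have "\<dots> < e" by (rule union_of_small_sets_small) (use FU Union.prems in auto)
    finally have "eventually (\<lambda>k. measure M (?D k) < e) sequentially"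
      using lim by (intro order_tendstoD) auto
    then obtain k where k: "measure M (?D k) < e" by (auto simp: eventually_sequentially)
    have "closedin S (\<Union>i\<le>k. F i)" using FU(1) by (intro closedin_Union) auto
    moreover have "openin S (\<Union>i. U i)" using FU(2) by (intro openin_Union) auto
    moreover have "(\<Union>i\<le>k. F i) \<subseteq> (\<Union>i. A i)" "(\<Union>i. A i) \<subseteq> (\<Union>i. U i)"
      using FU(3,4) by blast+
    ultimately show ?case using k by blast
  qed
qed

text \<open>
  Ulam's theorem: for every \<open>k\<close>, finitely many balls of radius \<open>1 / (k + 1)\<close> carry all but
  \<open>e / 2\<^sup>k\<^sup>+\<^sup>2\<close> of the mass. The intersection over \<open>k\<close> of these finite unions is closed and totally bounded,
  hence compact by completeness.
\<close>

lemma (in prob_space) polish_tight: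
  assumes pol: "polish_topology S" and top: "topspace S = space M"
    and op: "\<And>U. openin S U \<Longrightarrow> U \<in> sets M" and e: "0 < e"
  shows "\<exists>K. compactin S K \<and> measure M (space M - K) < e"
proof -
  obtain X m where met: "Metric_space X m" and compl: "Metric_space.mcomplete X m"
      and S: "S = Metric_space.mtopology X m"
    using pol unfolding polish_topology_def completely_metrizable_space_def by blast
  interpret m: Metric_space X m by (rule met)
  have X: "X = space M" using top S by simp
  have cl: "F \<in> sets M" if "closedin S F" for F
    by (rule closedin_measurable[OF top op that])
  have "\<exists>C. finite C \<and> C \<subseteq> X \<and> measure M (space M - (\<Union>x\<in>C. m.mcball x (1 / Suc k))) < e / 2 ^ (k + 2)"
    for k
  proof -
    have "\<exists>V. countable V \<and> V \<subseteq> (\<lambda>x. m.mball x (1 / Suc k)) ` X \<and> \<Union> V = topspace S"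
      using pol second_countable_imp_Lindelof_space[of S]
      by (intro Lindelof_spaceD) (auto simp: polish_topology_def S)
    then obtain V where V: "countable V" "V \<subseteq> (\<lambda>x. m.mball x (1 / Suc k)) ` X" "\<Union> V = X"
      using S by auto
    have ne: "V \<noteq> {}" using V(3) X not_empty by auto
    define B where "B = from_nat_into V"
    have rB: "range B = V" unfolding B_def using V(1) ne by (simp add: range_from_nat_into)
    then have "\<forall>i. \<exists>x\<in>X. B i = m.mball x (1 / Suc k)" using V(2) by blast
    then obtain c where c: "\<And>i. c i \<in> X" "\<And>i. B i = m.mball (c i) (1 / Suc k)" by metis
    have [measurable]: "B i \<in> sets M" for i unfolding c(2) by (intro op) (simp add: S)
    have "(\<lambda>n. measure M (space M - (\<Union>i\<le>n. B i))) \<longlonglongrightarrow> measure M (\<Inter>n. space M - (\<Union>i\<le>n. B i))"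
      by (intro finite_Lim_measure_decseq) (auto simp: decseq_def)
    also have "(\<Inter>n. space M - (\<Union>i\<le>n. B i)) = {}" using V(3) rB X by auto
    finally have "eventually (\<lambda>n. measure M (space M - (\<Union>i\<le>n. B i)) < e / 2 ^ (k + 2)) sequentially"
      using e by (intro order_tendstoD) auto
    then obtain n where n: "measure M (space M - (\<Union>i\<le>n. B i)) < e / 2 ^ (k + 2)"
      by (auto simp: eventually_sequentially)
    have "measure M (space M - (\<Union>x\<in>c ` {..n}. m.mcball x (1 / Suc k)))
        \<le> measure M (space M - (\<Union>i\<le>n. B i))"
      using \<open>\<And>i. B i \<in> sets M\<close> unfolding c(2)
      by (intro finite_measure_mono) auto
    with n c(1) show ?thesis by (intro exI[of _ "c ` {..n}"]) auto
  qed
  then obtain C where C: "\<And>k. finite (C k)" "\<And>k. C k \<subseteq> X"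
      "\<And>k. measure M (space M - (\<Union>x\<in>C k. m.mcball x (1 / Suc k))) < e / 2 ^ (k + 2)"
    by metis
  define L where "L = (\<lambda>k. \<Union>x\<in>C k. m.mcball x (1 / Suc k))"
  define K where "K = (\<Inter>k. L k)"
  have Lc: "closedin S (L k)" for k
    unfolding L_def S using C(1) by (intro closedin_Union) auto
  have Kc: "closedin S K" unfolding K_def using Lc by (intro closedin_INT) auto
  have "m.mtotally_bounded K"
    unfolding m.mtotally_bounded_def
  proof (intro allI impI)
    fix r :: real assume r: "0 < r"
    obtain k where k: "1 / Suc k < r / 2"
      using r by (metis nat_approx_posE half_gt_zero)
    \<comment> \<open>Total boundedness asks for centres in \<open>K\<close> itself; moving a centre into \<open>K\<close> doubles the radius.\<close>
    define p where "p = (\<lambda>x. SOME y. y \<in> K \<inter> m.mcball x (1 / Suc k))"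
    define D where "D = {x \<in> C k. K \<inter> m.mcball x (1 / Suc k) \<noteq> {}}"
    have p: "p x \<in> K \<inter> m.mcball x (1 / Suc k)" if "x \<in> D" for x
      using that unfolding p_def D_def by (metis (mono_tags, lifting) ex_in_conv mem_Collect_eq someI_ex)
    have "K \<subseteq> (\<Union>y\<in>p ` D. m.mball y r)"
    proof
      fix z assume z: "z \<in> K"
      then have "z \<in> L k" by (auto simp: K_def)
      then obtain x where x: "x \<in> C k" "z \<in> m.mcball x (1 / Suc k)" by (auto simp: L_def)
      then have "x \<in> D" using z by (auto simp: D_def)
      moreover have "m (p x) z < r"
        using p[OF \<open>x \<in> D\<close>] x(2) k m.triangle[of "p x" x z] m.commute[of "p x" x] by auto
      ultimately show "z \<in> (\<Union>y\<in>p ` D. m.mball y r)" using p[OF \<open>x \<in> D\<close>] x(2) by auto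
    qed
    then show "\<exists>D. finite D \<and> D \<subseteq> K \<and> K \<subseteq> (\<Union>x\<in>D. m.mball x r)"
      using p C(1) by (intro exI[of _ "p ` D"]) (auto simp: D_def)
  qed
  then have "compactin S (S closure_of K)"
    using m.mtotally_bounded_eq_compact_closure_of[OF compl] S by auto
  then have "compactin S K" using Kc closure_of_closedin by metis
  moreover have "measure M (space M - K) < e"
  proof -
    have "space M - K = (\<Union>k. space M - L k)" by (auto simp: K_def)
    then show ?thesis
      using union_of_small_sets_small[of "\<lambda>k. space M - L k"] C(3) cl[OF Lc] e by (auto simp: L_def)
  qed
  ultimately show ?thesis by blast
qed

text \<open>
  This treats Borel measures and their completions alike: for a completion, a measurable set lies
  between two Borel sets that differ by a null set, and the closed set is taken for the lower one, the
  open set for the upper one.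
\<close>

lemma standard_prob_space_regular:
  assumes "standard_prob_space M"
  obtains S where "polish_topology S" "topspace S = space M" "\<And>U. openin S U \<Longrightarrow> U \<in> sets M"
    "\<And>A e. A \<in> sets M \<Longrightarrow> 0 < e \<Longrightarrow>
      \<exists>F U. closedin S F \<and> openin S U \<and> F \<subseteq> A \<and> A \<subseteq> U \<and> measure M (U - F) < e"
proof -
  have pM: "prob_space M" using assms by (simp add: standard_prob_space_def)
  have met: "metrizable_space S" if "polish_topology S" for S :: "'a topology"
    using that completely_metrizable_imp_metrizable_space by (auto simp: polish_topology_def)
  show ?thesis
  proof (cases "standard_borel M")
    case True
    then obtain S where S: "polish_topology S" "topspace S = space M"
        "sets M = sigma_sets (space M) {U. openin S U}"
      unfolding standard_borel_def by blast
    interpret prob_space M by (rule pM)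
    show ?thesis
      using metrizable_borel_regular[OF met[OF S(1)] S(2,3)] S
      by (intro that[of S]) (auto intro: sigma_sets.Basic)
  next
    case False
    then obtain N where N: "standard_borel N" "M = completion N"
      using assms unfolding standard_prob_space_def by blast
    then obtain S where S: "polish_topology S" "topspace S = space N"
        "sets N = sigma_sets (space N) {U. openin S U}"
      unfolding standard_borel_def by blast
    have "emeasure N (space N) = 1"
      using prob_space.emeasure_space_1[OF pM] unfolding N(2) by simp
    then interpret N: prob_space N by (rule prob_spaceI)
    have op: "openin S U \<Longrightarrow> U \<in> sets N" for U using S(3) by (auto intro: sigma_sets.Basic)
    have cl: "F \<in> sets N" if "closedin S F" for F
      by (rule closedin_measurable[OF S(2) op that])
    show ?thesis
    proof (rule that[of S])
      fix A and e :: real assume A: "A \<in> sets M" and e: "0 < e"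
      obtain B Z Z' where B: "A = B \<union> Z" "Z \<subseteq> Z'" "Z' \<in> null_sets N" "B \<in> sets N"
        using A unfolding N(2) by (rule sets_completionE)
      have BZ: "B \<union> Z' \<in> sets N" using B by auto
      obtain F1 U1 where 1: "closedin S F1" "openin S U1" "F1 \<subseteq> B" "B \<subseteq> U1" "measure N (U1 - F1) < e / 2"
        using N.metrizable_borel_regular[OF met[OF S(1)] S(2,3) B(4), of "e / 2"] e by auto
      obtain F2 U2 where 2: "closedin S F2" "openin S U2" "F2 \<subseteq> B \<union> Z'" "B \<union> Z' \<subseteq> U2" "measure N (U2 - F2) < e / 2"
        using N.metrizable_borel_regular[OF met[OF S(1)] S(2,3) BZ, of "e / 2"] e by auto
      note [measurable] = op[OF 1(2)] op[OF 2(2)] cl[OF 1(1)] cl[OF 2(1)] B(4)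
      have [measurable]: "Z' \<in> sets N" using B(3) by auto
      have "measure N (U2 - F1) \<le> measure N ((U2 - F2) \<union> (U1 - F1) \<union> Z')"
        using 1 2 by (intro N.finite_measure_mono) auto
      also have "\<dots> = measure N ((U2 - F2) \<union> (U1 - F1))"
        using B(3) by (intro measure_Un_null_set) auto
      also have "\<dots> \<le> measure N (U2 - F2) + measure N (U1 - F1)"
        by (intro measure_Un_le) auto
      also have "\<dots> < e" using 1 2 by simp
      finally have "measure M (U2 - F1) < e" unfolding N(2) by simp
      then show "\<exists>F U. closedin S F \<and> openin S U \<and> F \<subseteq> A \<and> A \<subseteq> U \<and> measure M (U - F) < e"
        using 1 2 B by - (rule exI[of _ F1], rule exI[of _ U2], auto)
    qed (use S op N in auto)
  qed
qed

lemma (in Metric_space) separable_open_sets_measurable: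
  assumes "second_countable mtopology" and "\<And>x r. x \<in> M \<Longrightarrow> mball x r \<in> sets N"
    and U: "openin mtopology U"
  shows "U \<in> sets N"
proof -
  have "\<forall>x\<in>U. \<exists>r>0. mball x r \<subseteq> U" using U by (auto simp: openin_mtopology)
  then obtain r where r: "\<And>x. x \<in> U \<Longrightarrow> 0 < r x \<and> mball x (r x) \<subseteq> U" by metis
  have UM: "U \<subseteq> M" using U by (auto simp: openin_mtopology)
  have "Lindelof_space (subtopology mtopology U)"
    using assms(1) by (intro second_countable_imp_Lindelof_space second_countable_subtopology)
  then have "\<exists>V. countable V \<and> V \<subseteq> (\<lambda>x. mball x (r x)) ` U \<and> \<Union> V = topspace (subtopology mtopology U)"
  proof (rule Lindelof_spaceD)
    show "openin (subtopology mtopology U) B" if "B \<in> (\<lambda>x. mball x (r x)) ` U" for B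
      using that r unfolding openin_open_subtopology[OF U] by blast
    have "(\<Union>x\<in>U. mball x (r x)) = U" using r UM by (fastforce simp del: in_mball)
    then show "(\<Union>x\<in>U. mball x (r x)) = topspace (subtopology mtopology U)"
      using UM by (simp add: Int_absorb1)
  qed
  then obtain V where V: "countable V" "V \<subseteq> (\<lambda>x. mball x (r x)) ` U" "\<Union> V = U"
    using UM by (auto simp: Int_absorb1)
  have "\<Union> V \<in> sets N" using V(1,2) assms(2) UM by (intro sets.countable_Union) auto
  then show ?thesis using V by simp
qed

lemma (in Metric_space) compact_space_imp_second_countable:
  assumes "compact_space mtopology"
  shows "second_countable mtopology"
proof -
  have "mtotally_bounded M" using assms by (simp add: compact_space_eq_mcomplete_mtotally_bounded)
  then have "\<forall>k::nat. \<exists>C. finite C \<and> C \<subseteq> M \<and> M \<subseteq> (\<Union>x\<in>C. mball x (1 / Suc k))"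
    unfolding mtotally_bounded_def by simp
  then obtain C where C: "\<And>k::nat. finite (C k)" "\<And>k. C k \<subseteq> M" "\<And>k. M \<subseteq> (\<Union>x\<in>C k. mball x (1 / Suc k))"
    by metis
  define B where "B = (\<Union>k. (\<lambda>x. mball x (1 / Suc k)) ` C k)"
  show ?thesis unfolding second_countable_def
  proof (intro exI[of _ B] conjI allI impI ballI)
    show "countable B" unfolding B_def using C(1) by (auto intro: countable_finite)
    show "openin mtopology V" if "V \<in> B" for V using that by (auto simp: B_def)
    fix U x assume Ux: "openin mtopology U \<and> x \<in> U"
    then obtain r where r: "0 < r" "mball x r \<subseteq> U" "x \<in> M"
      unfolding openin_mtopology by blast
    obtain k where k: "1 / Suc k < r / 2" using r(1) by (metis nat_approx_posE half_gt_zero)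
    obtain c where c: "c \<in> C k" "x \<in> mball c (1 / Suc k)" using C(3)[of k] r(3) by auto
    have "mball c (1 / Suc k) \<subseteq> mball x r"
      using c k r(3) by (intro mball_subset) (auto simp: commute)
    then show "\<exists>V\<in>B. x \<in> V \<and> V \<subseteq> U" using c r by (intro bexI[of _ "mball c (1 / Suc k)"]) (auto simp: B_def)
  qed
qed

text \<open>
  The topology \<open>Y\<close> may have nothing to do with the Polish topology \<open>S\<close>, except that its open sets are
  measurable. As in Lusin's theorem, approximate each member \<open>b i\<close> of a countable base of \<open>Y\<close> between an
  \<open>S\<close>-closed set \<open>F i\<close> and an \<open>S\<close>-open set \<open>U i\<close>, and remove the small \<open>S\<close>-open set \<open>R\<close>, the union of
  all \<open>U i - F i\<close>. On the remaining set \<open>b i\<close> and \<open>U i\<close> agree, so the identity is continuous from \<open>S\<close>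
  to \<open>Y\<close> there, and it maps \<open>S\<close>-compact sets to \<open>Y\<close>-compact sets.
\<close>

lemma standard_prob_space_inner_regular_wrt_measurable_topology:
  assumes std: "standard_prob_space M"
    and haus: "Hausdorff_space Y" "second_countable Y" and topY: "topspace Y = space M"
    and opY: "\<And>U. openin Y U \<Longrightarrow> U \<in> sets M"
    and A: "A \<in> sets M" and e: "0 < e"
  shows "\<exists>K\<subseteq>A. compactin Y K \<and> measure M (A - K) < e"
proof -
  obtain S where S: "polish_topology S" "topspace S = space M" "\<And>U. openin S U \<Longrightarrow> U \<in> sets M"
    and reg: "\<And>A e. A \<in> sets M \<Longrightarrow> 0 < e \<Longrightarrow>
      \<exists>F U. closedin S F \<and> openin S U \<and> F \<subseteq> A \<and> A \<subseteq> U \<and> measure M (U - F) < e"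
    using standard_prob_space_regular[OF std] by metis
  interpret prob_space M using std by (simp add: standard_prob_space_def)
  have cl: "F \<in> sets M" if "closedin S F" for F
    by (rule closedin_measurable[OF S(2,3) that])
  obtain \<B> where \<B>: "countable \<B>" "\<And>V. V \<in> \<B> \<Longrightarrow> openin Y V"
      "\<And>U x. openin Y U \<Longrightarrow> x \<in> U \<Longrightarrow> \<exists>V\<in>\<B>. x \<in> V \<and> V \<subseteq> U"
    using haus(2) unfolding second_countable_def by metis
  \<comment> \<open>\<open>from_nat_into\<close> enumerates nonempty collections only; adding the empty set ensures this.\<close>
  define b where "b = from_nat_into (insert {} \<B>)"
  have rb: "range b = insert {} \<B>" unfolding b_def using \<B>(1) by (simp add: range_from_nat_into)
  have ob: "openin Y (b i)" for i
    using rb \<B>(2) by (metis insertE openin_empty rangeI)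
  have "\<forall>i. \<exists>F U. closedin S F \<and> openin S U \<and> F \<subseteq> b i \<and> b i \<subseteq> U
      \<and> measure M (U - F) < (e / 3) / 2 ^ (i + 2)"
    using reg[OF opY[OF ob]] e by simp
  then obtain F U where FU: "\<And>i. closedin S (F i)" "\<And>i. openin S (U i)" "\<And>i. F i \<subseteq> b i"
      "\<And>i. b i \<subseteq> U i" "\<And>i. measure M (U i - F i) < (e / 3) / 2 ^ (i + 2)"
    by metis
  obtain K0 where K0: "compactin S K0" "measure M (space M - K0) < e / 3"
    using polish_tight[OF S, of "e / 3"] e by auto
  obtain F0 V0 where F0: "closedin S F0" "openin S V0" "F0 \<subseteq> A" "A \<subseteq> V0" "measure M (V0 - F0) < e / 3"
    using reg[OF A, of "e / 3"] e by auto
  define R where "R = (\<Union>i. U i - F i)"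
  have R: "openin S R" unfolding R_def using FU by (intro openin_Union) auto
  define K where "K = K0 \<inter> (F0 - R)"
  have Kc: "compactin S K" unfolding K_def
    using K0(1) F0(1) R by (intro compact_Int_closedin closedin_diff)
  have KA: "K \<subseteq> A" "K \<subseteq> space M" using F0(3) A sets.sets_into_space by (auto simp: K_def)
  have cont: "continuous_map (subtopology S K) Y id"
    unfolding continuous_map_def
  proof (intro conjI allI impI)
    show "id \<in> topspace (subtopology S K) \<rightarrow> topspace Y" using topY S(2) by auto
    fix W assume W: "openin Y W"
    show "openin (subtopology S K) {x \<in> topspace (subtopology S K). id x \<in> W}"
      unfolding openin_subopen[of _ "{x \<in> topspace (subtopology S K). id x \<in> W}"]
    proof (intro ballI)
      fix x assume "x \<in> {x \<in> topspace (subtopology S K). id x \<in> W}"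
      then have x: "x \<in> K" "x \<in> W" by auto
      obtain V where V: "V \<in> \<B>" "x \<in> V" "V \<subseteq> W" using \<B>(3)[OF W x(2)] by auto
      then obtain i where i: "V = b i" using rb by (metis insertCI rangeE)
      have "U i \<inter> K \<subseteq> b i" using FU(3) by (auto simp: K_def R_def)
      moreover have "openin (subtopology S K) (U i \<inter> K)"
        using FU(2) by (auto simp: openin_subtopology)
      ultimately show "\<exists>T. openin (subtopology S K) T \<and> x \<in> T \<and> T \<subseteq> {x \<in> topspace (subtopology S K). id x \<in> W}"
        using x V i FU(4)[of i] KA S(2) by (intro exI[of _ "U i \<inter> K"]) auto
    qed
  qed
  have "compactin (subtopology S K) K" using Kc by (simp add: compactin_subtopology)
  then have "compactin Y (id ` K)" using cont by (rule image_compactin)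
  then have KY: "compactin Y K" by simp
  have sR: "R \<in> sets M" using S(3)[OF R] .
  have Rm: "measure M R < e / 3" unfolding R_def
    by (rule union_of_small_sets_small) (use FU e S(3) cl in auto)
  have K0s: "K0 \<in> sets M"
    using compactin_imp_closedin[OF _ K0(1)] cl S(1) completely_metrizable_imp_metrizable_space
      metrizable_imp_Hausdorff_space by (auto simp: polish_topology_def)
  note [measurable] = sR K0s cl[OF F0(1)] S(3)[OF F0(2)] A
  have "measure M (A - K) \<le> measure M (((space M - K0) \<union> (V0 - F0)) \<union> R)"
    using F0 sets.sets_into_space[OF A] by (intro finite_measure_mono) (auto simp: K_def)
  also have "\<dots> \<le> measure M ((space M - K0) \<union> (V0 - F0)) + measure M R"
    by (intro measure_Un_le) auto
  also have "\<dots> \<le> (measure M (space M - K0) + measure M (V0 - F0)) + measure M R"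
    by (intro add_right_mono measure_Un_le) auto
  also have "\<dots> < e" using K0(2) F0(5) Rm by simp
  finally show ?thesis using KA(1) KY by blast
qed

section \<open>Weights on words, the Gibbs inequality and subadditive sequences\<close>

definition words :: "'s set \<Rightarrow> nat \<Rightarrow> 's list set" where
  "words P n = {w. set w \<subseteq> P \<and> length w = n}"

lemma finite_words [intro, simp]: "finite P \<Longrightarrow> finite (words P n)"
  unfolding words_def by (rule finite_lists_length_eq)

lemma words_0 [simp]: "words P 0 = {[]}"
  by (auto simp: words_def)

lemma sum_words_append:
  fixes f :: "'s list \<Rightarrow> 'b::comm_monoid_add"
  assumes "finite P"
  shows "(\<Sum>w\<in>words P (m + n). f w) = (\<Sum>u\<in>words P m. \<Sum>v\<in>words P n. f (u @ v))"
proof -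
  have "bij_betw (\<lambda>(u, v). u @ v) (words P m \<times> words P n) (words P (m + n))"
    by (rule bij_betw_byWitness[where f' = "\<lambda>w. (take m w, drop m w)"])
      (auto simp: words_def dest: in_set_takeD in_set_dropD)
  then show ?thesis
    by (simp add: sum.cartesian_product sum.reindex_bij_betw[symmetric] case_prod_unfold)
qed

lemma sum_words_1: "(\<Sum>w\<in>words P (Suc 0). f w) = (\<Sum>A\<in>P. f [A])"
proof -
  have "words P (Suc 0) = (\<lambda>A. [A]) ` P" by (auto simp: words_def length_Suc_conv)
  then show ?thesis by (simp add: sum.reindex inj_on_def)
qed

lemma sum_words_prod:
  fixes f :: "nat \<Rightarrow> 's \<Rightarrow> 'b::comm_semiring_1"
  assumes "finite P"
  shows "(\<Sum>w\<in>words P n. \<Prod>i<n. f i (w ! i)) = (\<Prod>i<n. \<Sum>A\<in>P. f i A)"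
proof (induction n)
  case (Suc n)
  have "(\<Sum>w\<in>words P (n + Suc 0). \<Prod>i<Suc n. f i (w ! i))
      = (\<Sum>u\<in>words P n. \<Sum>A\<in>P. (\<Prod>i<n. f i (u ! i)) * f n A)"
    unfolding sum_words_append[OF assms] sum_words_1
    by (intro sum.cong refl) (auto simp: words_def nth_append intro!: arg_cong2[of _ _ _ _ "(*)"] prod.cong)
  also have "\<dots> = (\<Prod>i<Suc n. \<Sum>A\<in>P. f i A)"
    by (simp add: sum_distrib_left[symmetric] sum_distrib_right[symmetric] Suc.IH)
  finally show ?case by simp
qed simp

text \<open>
  A renewal-type sum: \<open>parse_weight u w\<close> is the sum, over all ways to write \<open>w\<close> as a concatenation of
  nonempty blocks, of the product of the block weights \<open>u\<close>. Keeping all parsings, instead of one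
  preferred parsing, makes the total weight multiplicative over the first block, while any particular
  parsing still gives a lower bound.
\<close>

fun parse_weight :: "('s list \<Rightarrow> real) \<Rightarrow> 's list \<Rightarrow> real" where
  "parse_weight u w =
    (if w = [] then 1 else \<Sum>n\<in>{1..length w}. u (take n w) * parse_weight u (drop n w))"

declare parse_weight.simps [simp del]

lemma parse_weight_Nil [simp]: "parse_weight u [] = 1"
  by (simp add: parse_weight.simps)

lemma parse_weight_nonneg:
  assumes "\<And>v. 0 \<le> u v"
  shows "0 \<le> parse_weight u w"
proof (induction w rule: length_induct)
  case (1 w)
  then show ?case
    by (subst parse_weight.simps) (auto intro!: sum_nonneg mult_nonneg_nonneg assms)
qed

lemma parse_weight_ge_first_block:
  assumes "\<And>v. 0 \<le> u v" and "1 \<le> n" "n \<le> length w"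
  shows "u (take n w) * parse_weight u (drop n w) \<le> parse_weight u w"
proof -
  have "u (take n w) * parse_weight u (drop n w)
      \<le> (\<Sum>n\<in>{1..length w}. u (take n w) * parse_weight u (drop n w))"
    using assms by (intro member_le_sum) (auto intro!: mult_nonneg_nonneg parse_weight_nonneg)
  also have "\<dots> = parse_weight u w"
    using assms by (subst (2) parse_weight.simps) auto
  finally show ?thesis .
qed

text \<open>
  Block weights of total mass at most 1, over all lengths together, generate a subprobability on the
  words of each fixed length: splitting off the first block, of length \<open>n\<close>, leaves the same problem
  for length \<open>N - n\<close>.
\<close>

lemma sum_parse_weight_le_1:
  assumes P: "finite P" and u: "\<And>v. 0 \<le> u v"
    and kraft: "\<And>K. (\<Sum>n\<in>{1..K}. \<Sum>w\<in>words P n. u w) \<le> 1"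
  shows "(\<Sum>w\<in>words P N. parse_weight u w) \<le> 1"
proof (induction N rule: less_induct)
  case (less N)
  show ?case
  proof (cases "N = 0")
    case False
    have "(\<Sum>w\<in>words P N. parse_weight u w)
        = (\<Sum>w\<in>words P N. \<Sum>n\<in>{1..N}. u (take n w) * parse_weight u (drop n w))"
      using False by (intro sum.cong refl, subst parse_weight.simps) (auto simp: words_def)
    also have "\<dots> = (\<Sum>n\<in>{1..N}. \<Sum>w\<in>words P N. u (take n w) * parse_weight u (drop n w))"
      by (rule sum.swap)
    also have "\<dots> = (\<Sum>n\<in>{1..N}. (\<Sum>v\<in>words P n. u v) * (\<Sum>w\<in>words P (N - n). parse_weight u w))"
    proof (intro sum.cong refl)
      fix n assume n: "n \<in> {1..N}"
      have "(\<Sum>w\<in>words P (n + (N - n)). u (take n w) * parse_weight u (drop n w))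
          = (\<Sum>v\<in>words P n. \<Sum>w\<in>words P (N - n). u v * parse_weight u w)"
        unfolding sum_words_append[OF P] by (intro sum.cong refl) (auto simp: words_def)
      then show "(\<Sum>w\<in>words P N. u (take n w) * parse_weight u (drop n w))
          = (\<Sum>v\<in>words P n. u v) * (\<Sum>w\<in>words P (N - n). parse_weight u w)"
        using n by (simp add: sum_product)
    qed
    also have "\<dots> \<le> (\<Sum>n\<in>{1..N}. (\<Sum>v\<in>words P n. u v) * 1)"
      using less.IH by (intro sum_mono mult_left_mono sum_nonneg u) auto
    also have "\<dots> \<le> 1" using kraft[of N] by simp
    finally show ?thesis .
  qed simp
qed

lemma parse_weight_ge_letterwise:
  assumes u: "\<And>v. 0 \<le> u v" and k: "\<And>A. A \<in> P \<Longrightarrow> exp (- k) \<le> u [A]"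
    and w: "w \<in> words P N"
  shows "exp (- (k * real N)) \<le> parse_weight u w"
  using w
proof (induction N arbitrary: w)
  case (Suc N)
  then obtain A v where w: "w = A # v" "A \<in> P" "v \<in> words P N"
    by (auto simp: words_def length_Suc_conv)
  have "exp (- (k * real (Suc N))) = exp (- k) * exp (- (k * real N))"
    by (simp add: exp_add[symmetric] algebra_simps)
  also have "\<dots> \<le> u [A] * parse_weight u v"
    using Suc.IH[OF w(3)] k[OF w(2)] u by (intro mult_mono) auto
  also have "\<dots> \<le> parse_weight u w"
    using parse_weight_ge_first_block[OF u, of 1 w] w(1) by simp
  finally show ?case .
qed simp

text \<open>
  The mean code length of any subprobability \<open>q\<close> bounds the entropy of \<open>p\<close>; this is \<open>ln t \<le> t - 1\<close> for
  \<open>t = q / p\<close>. Since \<open>ln 0 = 0\<close>, it would fail if \<open>q\<close> vanished where \<open>p\<close> is positive.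
\<close>

lemma gibbs_inequality:
  fixes p q :: "'s \<Rightarrow> real"
  assumes W: "finite W" and p: "\<And>w. w \<in> W \<Longrightarrow> 0 \<le> p w" and q: "\<And>w. w \<in> W \<Longrightarrow> 0 \<le> q w"
    and pq: "\<And>w. w \<in> W \<Longrightarrow> 0 < p w \<Longrightarrow> 0 < q w"
    and p1: "sum p W = 1" and q1: "sum q W \<le> 1"
  shows "(\<Sum>w\<in>W. - (p w * ln (p w))) \<le> (\<Sum>w\<in>W. p w * - ln (q w))"
proof -
  have "p w * ln (q w) - p w * ln (p w) \<le> q w - p w" if w: "w \<in> W" for w
  proof (cases "p w = 0")
    case False
    then have pw: "0 < p w" "0 < q w" using p[OF w] pq[OF w] by auto
    have "p w * ln (q w / p w) \<le> p w * (q w / p w - 1)"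
      using pw by (intro mult_left_mono ln_le_minus_one) auto
    then show ?thesis using pw by (simp add: ln_div algebra_simps)
  qed (use q[OF w] in auto)
  then have "(\<Sum>w\<in>W. p w * ln (q w) - p w * ln (p w)) \<le> (\<Sum>w\<in>W. q w - p w)" by (rule sum_mono)
  also have "\<dots> \<le> 0" using p1 q1 by (simp add: sum_subtractf)
  finally show ?thesis by (simp add: sum_subtractf sum_negf)
qed

text \<open>
  Fekete's lemma. It guarantees that the \<open>lim\<close> in the definition of entropy denotes an actual limit.
\<close>

lemma subadditive_average_convergent:
  fixes a :: "nat \<Rightarrow> real"
  assumes nonneg: "\<And>n. 0 \<le> a n" and sub: "\<And>m n. a (m + n) \<le> a m + a n"
  shows "convergent (\<lambda>n. a n / real n)"
proof -
  define L where "L = (INF n\<in>{1..}. a n / real n)"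
  have bdd: "bdd_below ((\<lambda>n. a n / real n) ` {1..})"
    by (rule bdd_belowI2[of _ 0]) (simp add: nonneg)
  have "(\<lambda>n. a n / real n) \<longlonglongrightarrow> L"
  proof (rule LIMSEQ_I)
    fix e :: real assume e: "0 < e"
    have "(INF n\<in>{1..}. a n / real n) < L + e / 2" using e by (simp add: L_def)
    then obtain m where m: "1 \<le> m" "a m / real m < L + e / 2"
      using cInf_lessD[of "(\<lambda>n. a n / real n) ` {1..}" "L + e / 2"] by auto
    define B where "B = (\<Sum>r<m. a r)"
    have mult: "a (k * m + r) \<le> real k * a m + a r" for k r
    proof (induction k)
      case (Suc k)
      have "a (Suc k * m + r) \<le> a m + a (k * m + r)" using sub[of m "k * m + r"] by (simp add: add.assoc)
      then show ?case using Suc by (simp add: algebra_simps)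
    qed simp
    have bound: "a n / real n \<le> a m / real m + B / real n" if n: "0 < n" for n
    proof -
      have "a n \<le> real (n div m) * a m + a (n mod m)" using mult[of "n div m" "n mod m"] by simp
      also have "\<dots> \<le> real n / real m * a m + B"
      proof (intro add_mono mult_right_mono nonneg)
        show "real (n div m) \<le> real n / real m" by (rule of_nat_div_le_of_nat)
        show "a (n mod m) \<le> B" unfolding B_def using m(1) nonneg by (intro member_le_sum) auto
      qed
      finally show ?thesis using n m(1) by (simp add: field_simps)
    qed
    obtain n0 :: nat where n0: "2 * B / e < real n0" using reals_Archimedean2 by blast
    show "\<exists>no. \<forall>n\<ge>no. norm (a n / real n - L) < e"
    proof (intro exI[of _ "max 1 n0"] allI impI)
      fix n assume n: "max 1 n0 \<le> n"
      have "2 * B / e < real n" using n0 n by simp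
      then have B: "B / real n < e / 2" using n e by (simp add: field_simps)
      have "0 < n" using n by simp
      then have "a n / real n < L + e" using bound[of n] B m(2) by linarith
      moreover have "L \<le> a n / real n" unfolding L_def using n by (intro cINF_lower[OF bdd]) auto
      ultimately show "norm (a n / real n - L) < e" by simp
    qed
  qed
  then show ?thesis by (rule convergentI)
qed

section \<open>Entropy as a bound for codes of itineraries\<close>

locale measure_preserving_system = prob_space M for M :: "'a measure" +
  fixes T :: "'a \<Rightarrow> 'a"
  assumes pres: "measure_preserving M T"
begin

lemma T_measurable [measurable]: "T \<in> measurable M M"
  using pres by (simp add: measure_preserving_def)

lemma iterate_measurable [measurable]: "T ^^ n \<in> measurable M M"
  by (induction n) (auto simp: id_def intro: measurable_comp)

lemma iterate_space: "x \<in> space M \<Longrightarrow> (T ^^ n) x \<in> space M"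
  by (rule measurable_space[OF iterate_measurable])

lemma distr_T: "distr M M T = M"
  using pres by (intro measure_eqI) (auto simp: measure_preserving_def emeasure_distr)

lemma distr_iterate: "distr M M (T ^^ n) = M"
proof (induction n)
  case 0
  then show ?case by (simp add: id_def distr_id)
next
  case (Suc n)
  have "distr M M (T ^^ Suc n) = distr (distr M M (T ^^ n)) M T"
    by (subst distr_distr) auto
  then show ?case unfolding Suc.IH distr_T .
qed

lemma integral_iterate:
  fixes f :: "'a \<Rightarrow> real"
  assumes "f \<in> borel_measurable M"
  shows "(\<integral>x. f ((T ^^ n) x) \<partial>M) = (\<integral>x. f x \<partial>M)"
  using integral_distr[OF iterate_measurable assms, of n] by (simp add: distr_iterate)

lemma integrable_iterate:
  fixes f :: "'a \<Rightarrow> real"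
  assumes "integrable M f"
  shows "integrable M (\<lambda>x. f ((T ^^ n) x))"
  by (rule integrable_distr[OF iterate_measurable[of n]]) (simp add: distr_iterate assms)

end

locale partitioned_system = measure_preserving_system M T
  for M :: "'a measure" and T :: "'a \<Rightarrow> 'a" +
  fixes P :: "'a set set"
  assumes part: "finite_partition M P"
begin

definition cell :: "'a \<Rightarrow> 'a set" where
  "cell x = (THE A. A \<in> P \<and> x \<in> A)"

definition itinerary :: "nat \<Rightarrow> 'a \<Rightarrow> 'a set list" where
  "itinerary n x = map (\<lambda>i. cell ((T ^^ i) x)) [0..<n]"

definition cylinder :: "'a set list \<Rightarrow> 'a set" where
  "cylinder w = {x \<in> space M. itinerary (length w) x = w}"

lemma finite_P [simp, intro]: "finite P"
  using part by (simp add: finite_partition_def)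

lemma P_sets: "A \<in> P \<Longrightarrow> A \<in> sets M"
  using part by (auto simp: finite_partition_def)

lemma cell_unique: "A \<in> P \<Longrightarrow> x \<in> A \<Longrightarrow> cell x = A"
  using part unfolding cell_def finite_partition_def partition_on_def disjoint_def
  by (intro the_equality) blast+

lemma cell_mem: "x \<in> space M \<Longrightarrow> cell x \<in> P" "x \<in> space M \<Longrightarrow> x \<in> cell x"
  using part cell_unique unfolding finite_partition_def partition_on_def by (metis UnionE)+

lemma P_nonempty: "P \<noteq> {}"
  using cell_mem(1) not_empty by auto

lemma length_itinerary [simp]: "length (itinerary n x) = n"
  by (simp add: itinerary_def)

lemma itinerary_nth: "i < n \<Longrightarrow> itinerary n x ! i = cell ((T ^^ i) x)"
  by (simp add: itinerary_def)

lemma itinerary_words: "x \<in> space M \<Longrightarrow> itinerary n x \<in> words P n"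
  using cell_mem iterate_space by (auto simp: itinerary_def words_def)

lemma itinerary_append: "itinerary (m + n) x = itinerary m x @ itinerary n ((T ^^ m) x)"
proof (rule nth_equalityI)
  fix i assume "i < length (itinerary (m + n) x)"
  moreover have "(T ^^ (i - m)) ((T ^^ m) x) = (T ^^ i) x" if "m \<le> i"
    using that funpow_add[of "i - m" m T] by simp
  ultimately show "itinerary (m + n) x ! i = (itinerary m x @ itinerary n ((T ^^ m) x)) ! i"
    by (auto simp: itinerary_nth nth_append)
qed simp

lemma take_itinerary: "m \<le> n \<Longrightarrow> take m (itinerary n x) = itinerary m x"
  using itinerary_append[of m "n - m" x] by simp

lemma drop_itinerary: "m \<le> n \<Longrightarrow> drop m (itinerary n x) = itinerary (n - m) ((T ^^ m) x)"
  using itinerary_append[of m "n - m" x] by simp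

lemma cylinder_eq:
  assumes "w \<in> words P n"
  shows "cylinder w = space M \<inter> (\<Inter>i<n. (T ^^ i) -` (w ! i))"
proof -
  have len: "length w = n" and wP: "\<And>i. i < n \<Longrightarrow> w ! i \<in> P"
    using assms by (auto simp: words_def)
  have "itinerary n x = w \<longleftrightarrow> (\<forall>i<n. (T ^^ i) x \<in> w ! i)" if "x \<in> space M" for x
  proof -
    have "cell ((T ^^ i) x) = w ! i \<longleftrightarrow> (T ^^ i) x \<in> w ! i" if "i < n" for i
      using wP[OF that] cell_mem(2) cell_unique iterate_space[OF \<open>x \<in> space M\<close>] by metis
    then show ?thesis by (auto simp: list_eq_iff_nth_eq itinerary_nth len)
  qed
  then show ?thesis by (auto simp: cylinder_def len)
qed

lemma cylinder_sets [measurable]: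
  assumes "w \<in> words P n"
  shows "cylinder w \<in> sets M"
proof -
  have [measurable]: "w ! i \<in> sets M" if "i < n" for i
    using that assms P_sets nth_mem[of i w] unfolding words_def by blast
  have "cylinder w = {x \<in> space M. \<forall>i\<in>{..<n}. (T ^^ i) x \<in> w ! i}"
    unfolding cylinder_eq[OF assms] by auto
  also have "\<dots> \<in> sets M" by (intro sets.sets_Collect_finite_All) measurable
  finally show ?thesis .
qed

text \<open>
  Words, unlike cells of the refinement, can be cut and concatenated; two words give the same cell
  only if that cell is empty, which does not affect the entropy.
\<close>

lemma refinement_eq_cylinders: "refinement M T P n = cylinder ` words P n"
proof
  show "cylinder ` words P n \<subseteq> refinement M T P n"
  proof
    fix C assume "C \<in> cylinder ` words P n"
    then obtain w where w: "w \<in> words P n" "C = cylinder w" by auto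
    then show "C \<in> refinement M T P n"
      unfolding refinement_def using cylinder_eq[OF w(1)]
      by (intro CollectI exI[of _ "(!) w"]) (auto simp: words_def)
  qed
  show "refinement M T P n \<subseteq> cylinder ` words P n"
  proof
    fix C assume "C \<in> refinement M T P n"
    then obtain A where A: "\<forall>i<n. A i \<in> P" "C = space M \<inter> (\<Inter>i<n. (T ^^ i) -` A i)"
      unfolding refinement_def by auto
    have w: "map A [0..<n] \<in> words P n" using A by (auto simp: words_def)
    have "C = cylinder (map A [0..<n])" unfolding cylinder_eq[OF w] A(2) by auto
    then show "C \<in> cylinder ` words P n" using w by blast
  qed
qed

lemma partition_entropy_refinement:
  "partition_entropy M (refinement M T P n)
    = (\<Sum>w\<in>words P n. - (measure M (cylinder w) * ln (measure M (cylinder w))))"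
  unfolding partition_entropy_def refinement_eq_cylinders
proof (subst sum.reindex_nontrivial)
  fix v w assume vw: "v \<in> words P n" "w \<in> words P n" "v \<noteq> w" "cylinder v = cylinder w"
  then have "cylinder v = {}" by (auto simp: cylinder_def words_def)
  then show "- (measure M (cylinder v) * ln (measure M (cylinder v))) = 0" by simp
qed auto

lemma integral_itinerary:
  fixes g :: "'a set list \<Rightarrow> real"
  shows "(\<lambda>x. g (itinerary n x)) \<in> borel_measurable M"
    and "integrable M (\<lambda>x. g (itinerary n x))"
    and "(\<integral>x. g (itinerary n x) \<partial>M) = (\<Sum>w\<in>words P n. measure M (cylinder w) * g w)"
proof -
  have eq: "g (itinerary n x) = (\<Sum>w\<in>words P n. g w * indicator (cylinder w) x)"
    if "x \<in> space M" for x
  proof -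
    have "(\<Sum>w\<in>words P n. g w * indicator (cylinder w) x)
        = (\<Sum>w\<in>words P n. if w = itinerary n x then g w else 0)"
      using that by (intro sum.cong) (auto simp: cylinder_def words_def)
    then show ?thesis using itinerary_words[OF that] by (simp add: sum.delta)
  qed
  have int: "integrable M (\<lambda>x. \<Sum>w\<in>words P n. g w * indicator (cylinder w) x)"
    by (intro Bochner_Integration.integrable_sum integrable_mult_right integrable_real_indicator)
      (auto simp: emeasure_eq_measure)
  show i: "integrable M (\<lambda>x. g (itinerary n x))"
    using int by (subst Bochner_Integration.integrable_cong[OF refl eq]) auto
  then show "(\<lambda>x. g (itinerary n x)) \<in> borel_measurable M" by auto
  have "(\<integral>x. g (itinerary n x) \<partial>M) = (\<integral>x. (\<Sum>w\<in>words P n. g w * indicator (cylinder w) x) \<partial>M)"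
    by (intro Bochner_Integration.integral_cong refl eq)
  also have "\<dots> = (\<Sum>w\<in>words P n. \<integral>x. g w * indicator (cylinder w) x \<partial>M)"
    by (intro Bochner_Integration.integral_sum integrable_mult_right integrable_real_indicator)
      (auto simp: emeasure_eq_measure)
  also have "\<dots> = (\<Sum>w\<in>words P n. measure M (cylinder w) * g w)"
    by (intro sum.cong refl) (auto simp: mult.commute)
  finally show "(\<integral>x. g (itinerary n x) \<partial>M) = (\<Sum>w\<in>words P n. measure M (cylinder w) * g w)" .
qed

lemma sum_measure_cylinders: "(\<Sum>w\<in>words P n. measure M (cylinder w)) = 1"
  using integral_itinerary(3)[of "\<lambda>_. 1" n] prob_space by simp

lemma partition_entropy_le_code:
  fixes q :: "'a set list \<Rightarrow> real"
  assumes q0: "\<And>w. w \<in> words P n \<Longrightarrow> 0 \<le> q w" and q1: "sum q (words P n) \<le> 1"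
    and qpos: "\<And>w. w \<in> words P n \<Longrightarrow> 0 < measure M (cylinder w) \<Longrightarrow> 0 < q w"
  shows "partition_entropy M (refinement M T P n) \<le> (\<integral>x. - ln (q (itinerary n x)) \<partial>M)"
  unfolding partition_entropy_refinement integral_itinerary(3)[of "\<lambda>w. - ln (q w)" n]
  by (rule gibbs_inequality) (use assms sum_measure_cylinders in auto)

text \<open>
  Gibbs inequality for the product code: a word of length \<open>m + n\<close> receives the probability of its first
  \<open>m\<close> letters times that of its last \<open>n\<close> letters. The second factor contributes the entropy of \<open>n\<close>
  steps because \<open>T\<^sup>m\<close> preserves the measure.
\<close>

lemma partition_entropy_subadditive:
  "partition_entropy M (refinement M T P (m + n))
    \<le> partition_entropy M (refinement M T P m) + partition_entropy M (refinement M T P n)"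
proof -
  define p where "p = (\<lambda>w. measure M (cylinder w))"
  have ent: "partition_entropy M (refinement M T P k) = (\<integral>x. - ln (p (itinerary k x)) \<partial>M)" for k
    unfolding partition_entropy_refinement integral_itinerary(3)[of "\<lambda>w. - ln (p w)" k]
    by (simp add: p_def)
  define q where "q = (\<lambda>w. p (take m w) * p (drop m w))"
  have pos: "0 < p (take m w) \<and> 0 < p (drop m w)" if w: "w \<in> words P (m + n)" and "0 < p w" for w
  proof -
    have tw: "take m w \<in> words P m" "drop m w \<in> words P n"
      using w by (auto simp: words_def dest: in_set_takeD in_set_dropD)
    have len: "length w = m + n" using w by (simp add: words_def)
    have "p w \<le> p (take m w)"
      unfolding p_def using cylinder_sets[OF tw(1)]
      by (intro finite_measure_mono) (auto simp: cylinder_def len take_itinerary)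
    moreover have "p w \<le> measure M ((T ^^ m) -` cylinder (drop m w) \<inter> space M)"
      unfolding p_def using tw
      by (intro finite_measure_mono measurable_sets[OF iterate_measurable cylinder_sets])
        (auto simp: cylinder_def len drop_itinerary iterate_space)
    moreover have "measure M ((T ^^ m) -` cylinder (drop m w) \<inter> space M) = p (drop m w)"
      using measure_distr[OF iterate_measurable cylinder_sets[OF tw(2)], of m]
      by (simp add: distr_iterate p_def)
    ultimately show ?thesis using \<open>0 < p w\<close> by linarith
  qed
  have "partition_entropy M (refinement M T P (m + n))
      \<le> (\<Sum>w\<in>words P (m + n). p w * - ln (q w))"
    unfolding partition_entropy_refinement fun_cong[OF p_def, symmetric]
  proof (rule gibbs_inequality)
    have "sum q (words P (m + n)) = sum p (words P m) * sum p (words P n)"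
      unfolding sum_words_append[OF finite_P] sum_product
      by (intro sum.cong refl) (auto simp: q_def words_def)
    then show "sum q (words P (m + n)) \<le> 1" by (simp add: p_def sum_measure_cylinders)
  qed (use pos sum_measure_cylinders in \<open>auto simp: p_def q_def\<close>)
  also have "\<dots> = (\<Sum>w\<in>words P (m + n). p w * (- ln (p (take m w)) + - ln (p (drop m w))))"
  proof (intro sum.cong refl)
    fix w assume w: "w \<in> words P (m + n)"
    show "p w * - ln (q w) = p w * (- ln (p (take m w)) + - ln (p (drop m w)))"
    proof (cases "p w = 0")
      case False
      then have "0 < p w" by (simp add: p_def zero_less_measure_iff)
      then show ?thesis using pos[OF w] by (simp add: q_def ln_mult)
    qed simp
  qed
  also have "\<dots> = (\<integral>x. - ln (p (take m (itinerary (m + n) x))) + - ln (p (drop m (itinerary (m + n) x))) \<partial>M)"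
    unfolding integral_itinerary(3)[of "\<lambda>w. - ln (p (take m w)) + - ln (p (drop m w))" "m + n"]
    by (simp add: p_def)
  also have "\<dots> = (\<integral>x. - ln (p (itinerary m x)) + - ln (p (itinerary n ((T ^^ m) x))) \<partial>M)"
    by (simp add: take_itinerary drop_itinerary)
  also have "\<dots> = (\<integral>x. - ln (p (itinerary m x)) \<partial>M) + (\<integral>x. - ln (p (itinerary n ((T ^^ m) x))) \<partial>M)"
    using integral_itinerary(2)[of "\<lambda>w. - ln (p w)"]
    by (intro Bochner_Integration.integral_add integrable_iterate) auto
  also have "(\<integral>x. - ln (p (itinerary n ((T ^^ m) x))) \<partial>M) = (\<integral>x. - ln (p (itinerary n x)) \<partial>M)"
    using integral_itinerary(1)[of "\<lambda>w. - ln (p w)"] by (intro integral_iterate) auto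
  finally show ?thesis by (simp only: ent)
qed

lemma entropy_wrt_limit:
  "(\<lambda>n. partition_entropy M (refinement M T P n) / real n) \<longlonglongrightarrow> entropy_wrt M T P"
proof -
  have "0 \<le> partition_entropy M (refinement M T P n)" for n
    unfolding partition_entropy_def
  proof (intro sum_nonneg)
    fix A
    show "0 \<le> - (measure M A * ln (measure M A))"
      using prob_le_1[of A] measure_nonneg[of M A] ln_le_zero_iff[of "measure M A"]
      by (cases "measure M A = 0") (auto simp: zero_less_measure_iff mult_le_0_iff)
  qed
  then have "convergent (\<lambda>n. partition_entropy M (refinement M T P n) / real n)"
    using partition_entropy_subadditive by (rule subadditive_average_convergent)
  then show ?thesis unfolding entropy_wrt_def by (simp add: convergent_LIMSEQ_iff)
qed

text \<open>
  The greedy parsing of an orbit: from each point of the orbit, use a block whose cost is paid for by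
  the cost function \<open>f\<close> along the orbit. When the next block would overrun the time \<open>N\<close>, at most \<open>m\<close>
  letters are left, and these are coded singly at cost \<open>k\<close> each.
\<close>

lemma parse_weight_itinerary_ge:
  assumes u: "\<And>v. 0 \<le> u v" and k: "0 \<le> k" "\<And>A. A \<in> P \<Longrightarrow> exp (- k) \<le> u [A]"
    and f: "\<And>x. 0 \<le> f x"
    and stop: "\<And>x. x \<in> space M \<Longrightarrow> \<exists>n\<in>{1..m}. exp (- (\<Sum>t<n. f ((T ^^ t) x))) \<le> u (itinerary n x)"
    and x: "x \<in> space M"
  shows "exp (- ((\<Sum>t<N. f ((T ^^ t) x)) + k * real m)) \<le> parse_weight u (itinerary N x)"
  using x
proof (induction N arbitrary: x rule: less_induct)
  case (less N)
  obtain n where n: "1 \<le> n" "n \<le> m" "exp (- (\<Sum>t<n. f ((T ^^ t) x))) \<le> u (itinerary n x)"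
    using stop[OF less.prems] by auto
  show ?case
  proof (cases "n \<le> N")
    case True
    let ?y = "(T ^^ n) x"
    have split: "(\<Sum>t<n + j. g t) = (\<Sum>t<n. g t) + (\<Sum>t<j. g (n + t))" for g :: "nat \<Rightarrow> real" and j
      by (induction j) (simp_all add: add.assoc)
    have "(\<Sum>t<N. f ((T ^^ t) x)) = (\<Sum>t<n. f ((T ^^ t) x)) + (\<Sum>t<N - n. f ((T ^^ (n + t)) x))"
      using split[of "\<lambda>t. f ((T ^^ t) x)" "N - n"] True by simp
    moreover have "(T ^^ (n + t)) x = (T ^^ t) ?y" for t
      using funpow_add[of t n T] by (simp add: add.commute)
    ultimately have "(\<Sum>t<N. f ((T ^^ t) x)) = (\<Sum>t<n. f ((T ^^ t) x)) + (\<Sum>t<N - n. f ((T ^^ t) ?y))"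
      by simp
    then have "exp (- ((\<Sum>t<N. f ((T ^^ t) x)) + k * real m))
        = exp (- (\<Sum>t<n. f ((T ^^ t) x))) * exp (- ((\<Sum>t<N - n. f ((T ^^ t) ?y)) + k * real m))"
      by (simp add: exp_add[symmetric] add.assoc)
    also have "\<dots> \<le> u (itinerary n x) * parse_weight u (itinerary (N - n) ?y)"
      using n less.IH[of "N - n" ?y] True iterate_space[OF less.prems] u by (intro mult_mono) auto
    also have "\<dots> \<le> parse_weight u (itinerary N x)"
      using parse_weight_ge_first_block[OF u n(1), of "itinerary N x"] True
      by (simp add: take_itinerary drop_itinerary)
    finally show ?thesis .
  next
    case False
    have "k * real N \<le> k * real m" using False n(2) k(1) by (intro mult_left_mono) auto
    moreover have "0 \<le> (\<Sum>t<N. f ((T ^^ t) x))" by (intro sum_nonneg f)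
    ultimately have "exp (- ((\<Sum>t<N. f ((T ^^ t) x)) + k * real m)) \<le> exp (- (k * real N))" by simp
    also have "\<dots> \<le> parse_weight u (itinerary N x)"
      by (rule parse_weight_ge_letterwise[of u P, OF u k(2) itinerary_words[OF less.prems]])
    finally show ?thesis .
  qed
qed

text \<open>
  Since the cost is a sum along the orbit, its mean over \<open>N\<close> steps is \<open>N\<close> times the integral of \<open>f\<close> by
  invariance of the measure, no matter at which times the blocks begin. The boundary cost \<open>k m\<close>
  disappears after division by \<open>N\<close>.
\<close>

lemma entropy_le_mean_block_code_length:
  assumes u: "\<And>v. 0 \<le> u v" and kraft: "\<And>K. (\<Sum>n\<in>{1..K}. \<Sum>w\<in>words P n. u w) \<le> 1"
    and k: "0 \<le> k" "\<And>A. A \<in> P \<Longrightarrow> exp (- k) \<le> u [A]"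
    and f: "integrable M f" "\<And>x. 0 \<le> f x"
    and stop: "\<And>x. x \<in> space M \<Longrightarrow> \<exists>n\<in>{1..m}. exp (- (\<Sum>t<n. f ((T ^^ t) x))) \<le> u (itinerary n x)"
  shows "entropy_wrt M T P \<le> (\<integral>x. f x \<partial>M)"
proof -
  have bound: "partition_entropy M (refinement M T P N) \<le> real N * (\<integral>x. f x \<partial>M) + k * real m" for N
  proof -
    let ?q = "parse_weight u"
    have intf: "integrable M (\<lambda>x. f ((T ^^ t) x))" for t by (rule integrable_iterate[OF f(1)])
    have "partition_entropy M (refinement M T P N) \<le> (\<integral>x. - ln (?q (itinerary N x)) \<partial>M)"
      using sum_parse_weight_le_1[OF finite_P u kraft] parse_weight_nonneg[of u, OF u]
        less_le_trans[OF exp_gt_zero parse_weight_ge_letterwise[of u P k, OF u k(2)]]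
      by (intro partition_entropy_le_code) auto
    also have "\<dots> \<le> (\<integral>x. (\<Sum>t<N. f ((T ^^ t) x)) + k * real m \<partial>M)"
    proof (rule integral_mono)
      show "integrable M (\<lambda>x. - ln (?q (itinerary N x)))" by (rule integral_itinerary(2))
      show "integrable M (\<lambda>x. (\<Sum>t<N. f ((T ^^ t) x)) + k * real m)"
        using intf by simp
      fix x assume x: "x \<in> space M"
      have "exp (- ((\<Sum>t<N. f ((T ^^ t) x)) + k * real m)) \<le> ?q (itinerary N x)"
        by (rule parse_weight_itinerary_ge) (use u k f(2) stop x in auto)
      then have "ln (exp (- ((\<Sum>t<N. f ((T ^^ t) x)) + k * real m))) \<le> ln (?q (itinerary N x))"
        by (subst ln_le_cancel_iff) (auto intro: less_le_trans[OF exp_gt_zero])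
      then show "- ln (?q (itinerary N x)) \<le> (\<Sum>t<N. f ((T ^^ t) x)) + k * real m" by simp
    qed
    also have "\<dots> = (\<Sum>t<N. \<integral>x. f ((T ^^ t) x) \<partial>M) + k * real m"
      using intf by (simp add: prob_space)
    also have "\<dots> = real N * (\<integral>x. f x \<partial>M) + k * real m"
      using f(1) by (simp add: integral_iterate)
    finally show ?thesis .
  qed
  have "(\<lambda>N. (\<integral>x. f x \<partial>M) + k * real m / real N) \<longlonglongrightarrow> (\<integral>x. f x \<partial>M) + 0"
    by (intro tendsto_add tendsto_const lim_const_over_n)
  then have "entropy_wrt M T P \<le> (\<integral>x. f x \<partial>M) + 0"
  proof (rule LIMSEQ_le[OF entropy_wrt_limit], intro exI[of _ 1] allI impI)
    fix N :: nat assume "1 \<le> N"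
    then show "partition_entropy M (refinement M T P N) / real N
        \<le> (\<integral>x. f x \<partial>M) + k * real m / real N"
      using bound[of N] by (simp add: field_simps)
  qed
  then show ?thesis by simp
qed

end

section \<open>Coding itineraries by Bowen balls\<close>

definition bowen_ball :: "'a measure \<Rightarrow> ('a \<Rightarrow> 'a \<Rightarrow> real) \<Rightarrow> ('a \<Rightarrow> 'a) \<Rightarrow> real \<Rightarrow> nat \<Rightarrow> 'a \<Rightarrow> 'a set" where
  "bowen_ball M d T \<delta> n x = {y \<in> space M. \<forall>t<n. d ((T ^^ t) x) ((T ^^ t) y) \<le> \<delta>}"

context partitioned_system
begin

text \<open>
  The coding argument. The sets \<open>K A\<close> nearly fill the cells \<open>A\<close>, and a point that is \<open>\<delta>\<close>-close to
  \<open>K A\<close> lies in \<open>V A\<close>, where the \<open>V A\<close> are disjoint. Read \<open>r A x\<close> as the probability to receive the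
  letter \<open>A\<close> when \<open>x\<close> is sent: with probability \<open>\<theta>\<close> a uniformly random letter, otherwise the letter
  whose \<open>V\<close> contains \<open>x\<close>. If \<open>y\<close> lies in \<open>K A\<close>, all points \<open>\<delta>\<close>-close to \<open>y\<close> produce the letter of \<open>y\<close>
  with probability at least \<open>1 - \<theta> = exp (- \<eta>)\<close>; in the small rest \<open>K0\<close> it is still at least \<open>\<theta> / card P\<close>.
  So averaging over the points sent, a block of length \<open>n\<close> of the itinerary of \<open>x\<close> is received with
  probability at least \<open>\<mu>(B\<^sub>n(x,\<delta>)) exp (- \<eta> n)\<close>, apart from an extra cost \<open>L\<close> for each visit to \<open>K0\<close>.
\<close>

lemma entropy_le_bowen_rate_plus_error:
  fixes K V :: "'a set \<Rightarrow> 'a set" and \<eta> c \<delta> :: real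
  assumes \<eta>: "0 < \<eta>" and c: "0 \<le> c"
    and K: "\<And>A. A \<in> P \<Longrightarrow> K A \<in> sets M" "\<And>A. A \<in> P \<Longrightarrow> K A \<subseteq> A"
    and V: "\<And>A. A \<in> P \<Longrightarrow> V A \<in> sets M" "disjoint_family_on V P"
    and near: "\<And>A x y. A \<in> P \<Longrightarrow> x \<in> K A \<Longrightarrow> y \<in> space M \<Longrightarrow> d x y \<le> \<delta> \<Longrightarrow> y \<in> V A"
    and Bm: "\<And>n x. x \<in> space M \<Longrightarrow> bowen_ball M d T \<delta> n x \<in> sets M"
      "\<And>n. (\<lambda>x. measure M (bowen_ball M d T \<delta> n x)) \<in> borel_measurable M"
    and rate: "\<And>n0. AE x in M. \<exists>n\<ge>n0. exp (- (c * real n)) \<le> measure M (bowen_ball M d T \<delta> n x)"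
  shows "entropy_wrt M T P \<le> c + 3 * \<eta>
    + ln (real (card P) / (1 - exp (- \<eta>))) * measure M (space M - (\<Union>A\<in>P. K A))"
proof -
  define m where "m = real (card P)"
  define \<theta> where "\<theta> = 1 - exp (- \<eta>)"
  define L where "L = ln (m / \<theta>)"
  define \<kappa> where "\<kappa> = ln (2 * m)"
  define K0 where "K0 = space M - (\<Union>A\<in>P. K A)"
  define r where "r = (\<lambda>A x. \<theta> / m + exp (- \<eta>) * indicator (V A) x)"
  have m: "1 \<le> m" using P_nonempty finite_P by (simp add: m_def Suc_leI card_gt_0_iff)
  have \<theta>: "0 < \<theta>" "\<theta> < 1" using \<eta> by (auto simp: \<theta>_def)
  have "1 \<le> m / \<theta>" using m \<theta> by simp
  then have L: "0 \<le> L" by (simp add: L_def)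
  have eL: "exp (- L) = \<theta> / m" using m \<theta> by (simp add: L_def exp_minus)
  have \<kappa>: "0 \<le> \<kappa>" "exp (- \<kappa>) = 1 / (2 * m)" using m by (auto simp: \<kappa>_def exp_minus field_simps)
  have K0s [measurable]: "K0 \<in> sets M" using K(1) by (auto simp: K0_def)
  have r_nonneg: "0 \<le> r A x" for A x using m \<theta> by (auto simp: r_def)
  have r_sum: "(\<Sum>A\<in>P. r A x) \<le> 1" for x
  proof -
    have "(\<Sum>A\<in>P. r A x) = \<theta> + exp (- \<eta>) * (\<Sum>A\<in>P. indicator (V A) x)"
      using m P_nonempty by (simp add: r_def sum.distrib sum_distrib_left m_def)
    also have "(\<Sum>A\<in>P. indicator (V A) x :: real) = indicator (\<Union>A\<in>P. V A) x"
      by (rule indicator_UN_disjoint[OF finite_P V(2), symmetric])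
    also have "\<theta> + exp (- \<eta>) * indicator (\<Union>A\<in>P. V A) x \<le> 1"
      by (auto simp: \<theta>_def indicator_def)
    finally show ?thesis .
  qed
  have r_meas: "(\<lambda>x. r A ((T ^^ i) x)) \<in> borel_measurable M" if "A \<in> P" for A i
    using V(1)[OF that] unfolding r_def by measurable
  have r_le: "r A x \<le> 1" if "A \<in> P" for A x
    using member_le_sum[of A P "\<lambda>A. r A x"] that r_nonneg r_sum[of x] by auto
  have prod_int: "integrable M (\<lambda>x. \<Prod>i<n. r (w ! i) ((T ^^ i) x))" if w: "w \<in> words P n" for w n
  proof (rule integrable_const_bound[of _ 1])
    have wi: "w ! i \<in> P" if "i < n" for i using w that nth_mem[of i w] unfolding words_def by blast
    show "(\<lambda>x. \<Prod>i<n. r (w ! i) ((T ^^ i) x)) \<in> borel_measurable M"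
      using wi by (intro borel_measurable_prod r_meas) auto
    show "AE x in M. norm (\<Prod>i<n. r (w ! i) ((T ^^ i) x)) \<le> 1"
      using wi r_nonneg r_le by (auto simp: abs_prod intro!: AE_I2 prod_le_1)
  qed
  \<comment> \<open>Blocks of length at least \<open>n0\<close> carry the factor \<open>exp (- \<eta> n)\<close>. This pays for announcing their length:
    their weights sum to at most \<open>1/2\<close>. The other half of the mass goes to single letters.\<close>
  have "summable (\<lambda>n. exp (- \<eta>) ^ n)" using \<eta> by (intro summable_geometric) simp
  then obtain n' where n': "\<And>k l. n' \<le> k \<Longrightarrow> norm (\<Sum>n\<in>{k..<l}. exp (- \<eta>) ^ n) < 1 / 2"
    unfolding summable_Cauchy by (metis half_gt_zero zero_less_one)
  define n0 where "n0 = max 2 n'"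
  define u where "u = (\<lambda>w. if length w = 1 then 1 / (2 * m) else if n0 \<le> length w
    then exp (- \<eta>) ^ length w * (\<integral>x. (\<Prod>i<length w. r (w ! i) ((T ^^ i) x)) \<partial>M) else 0)"
  have u_nonneg: "0 \<le> u w" for w
    unfolding u_def using m r_nonneg by (auto intro!: mult_nonneg_nonneg Bochner_Integration.integral_nonneg prod_nonneg)
  have kraft: "(\<Sum>n\<in>{1..k}. \<Sum>w\<in>words P n. u w) \<le> 1" for k
  proof -
    have block: "(\<Sum>w\<in>words P n. u w) \<le> (if n = 1 then 1 / 2 else 0) + (if n0 \<le> n then exp (- \<eta>) ^ n else 0)"
      for n
    proof (cases "n = 1")
      case True
      then show ?thesis using m by (simp add: sum_words_1 u_def n0_def m_def)
    next
      case n1: False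
      have len: "length w = n" if "w \<in> words P n" for w using that by (simp add: words_def)
      show ?thesis
      proof (cases "n0 \<le> n")
        case True
        have "(\<Sum>w\<in>words P n. u w)
            = exp (- \<eta>) ^ n * (\<Sum>w\<in>words P n. \<integral>x. (\<Prod>i<n. r (w ! i) ((T ^^ i) x)) \<partial>M)"
          unfolding sum_distrib_left using n1 True len by (intro sum.cong refl) (auto simp: u_def)
        also have "\<dots> = exp (- \<eta>) ^ n * (\<integral>x. (\<Sum>w\<in>words P n. \<Prod>i<n. r (w ! i) ((T ^^ i) x)) \<partial>M)"
          using prod_int by (subst Bochner_Integration.integral_sum) auto
        also have "\<dots> = exp (- \<eta>) ^ n * (\<integral>x. (\<Prod>i<n. \<Sum>A\<in>P. r A ((T ^^ i) x)) \<partial>M)"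
          by (subst sum_words_prod) auto
        also have "\<dots> \<le> exp (- \<eta>) ^ n * (\<integral>x. 1 \<partial>M)"
        proof (intro mult_left_mono integral_mono)
          show "integrable M (\<lambda>x. \<Prod>i<n. \<Sum>A\<in>P. r A ((T ^^ i) x))"
            using prod_int by (subst sum_words_prod[symmetric]) auto
        qed (auto intro!: prod_le_1 sum_nonneg r_nonneg r_sum)
        finally show ?thesis using n1 True by (simp add: prob_space)
      next
        case False
        then show ?thesis using n1 len by (simp add: u_def)
      qed
    qed
    have "(\<Sum>n\<in>{1..k}. \<Sum>w\<in>words P n. u w)
        \<le> (\<Sum>n\<in>{1..k}. if n = 1 then 1 / 2 else 0) + (\<Sum>n\<in>{1..k}. if n0 \<le> n then exp (- \<eta>) ^ n else 0)"
      unfolding sum.distrib[symmetric] by (intro sum_mono block)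
    also have "(\<Sum>n\<in>{1..k}. if n = 1 then 1 / 2 else 0) \<le> (1 / 2 :: real)"
      by (simp add: sum.delta)
    also have "(\<Sum>n\<in>{1..k}. if n0 \<le> n then exp (- \<eta>) ^ n else 0) = (\<Sum>n\<in>{n0..<Suc k}. exp (- \<eta>) ^ n)"
      unfolding sum.inter_filter[OF finite_atLeastAtMost, symmetric]
      by (intro sum.cong) (auto simp: n0_def)
    also have "\<dots> \<le> 1 / 2" using n'[of n0 "Suc k"] by (simp add: n0_def)
    finally show ?thesis by simp
  qed
  \<comment> \<open>Almost every point has a good block of length at least \<open>n0\<close>; blocks of length at most \<open>n1\<close> suffice
    outside a set so small that coding it by single letters at cost \<open>\<kappa>\<close> has mean cost at most \<open>\<eta>\<close>.\<close>
  define good where "good = (\<lambda>n x. exp (- (c * real n)) \<le> measure M (bowen_ball M d T \<delta> n x))"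
  have good_meas [measurable]: "Measurable.pred M (good n)" for n
    unfolding good_def using Bm(2)[of n] by measurable
  define G where "G = (\<lambda>k. {x \<in> space M. \<exists>n\<in>{n0..k}. good n x})"
  have G_sets [measurable]: "G k \<in> sets M" for k unfolding G_def by measurable
  have "(\<lambda>k. measure M (space M - G k)) \<longlonglongrightarrow> measure M (\<Inter>k. space M - G k)"
    by (intro finite_Lim_measure_decseq) (auto simp: decseq_def G_def)
  also have "measure M (\<Inter>k. space M - G k) = measure M {}"
  proof (rule finite_measure_eq_AE)
    show "AE x in M. x \<in> (\<Inter>k. space M - G k) \<longleftrightarrow> x \<in> {}"
      using rate[of n0]
    proof eventually_elim
      case (elim x)
      then obtain n where "n0 \<le> n" "good n x" by (auto simp: good_def)
      then show ?case by (auto simp: G_def intro!: exI[of _ n])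
    qed
  qed auto
  finally have "eventually (\<lambda>k. measure M (space M - G k) < \<eta> / (\<kappa> + 1)) sequentially"
    using \<eta> \<kappa> by (intro order_tendstoD) auto
  then obtain k' where k': "\<And>k. k' \<le> k \<Longrightarrow> measure M (space M - G k) < \<eta> / (\<kappa> + 1)"
    by (auto simp: eventually_sequentially)
  define n1 where "n1 = max n0 k'"
  have "\<kappa> * measure M (space M - G n1) \<le> (\<kappa> + 1) * measure M (space M - G n1)"
    by (intro mult_right_mono) auto
  also have "\<dots> \<le> \<eta>" using k'[of n1] \<kappa>(1) by (simp add: n1_def field_simps)
  finally have Gsmall: "\<kappa> * measure M (space M - G n1) \<le> \<eta>" .
  \<comment> \<open>Cost per unit of time: \<open>c\<close> for the Bowen ball, \<open>\<eta>\<close> for announcing the block length, \<open>\<eta>\<close> for the noise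
    of the channel, plus the penalties in \<open>K0\<close> and outside the points with a good block.\<close>
  define f where "f = (\<lambda>x. (c + 2 * \<eta>) + L * indicator K0 x + \<kappa> * indicator (space M - G n1) x)"
  have f_int: "integrable M f"
    unfolding f_def by (intro Bochner_Integration.integrable_add integrable_mult_right integrable_real_indicator)
      (auto simp: emeasure_eq_measure)
  have f_nonneg: "0 \<le> f x" for x
    unfolding f_def using c \<eta> L \<kappa>(1) by auto
  have stop: "\<exists>n\<in>{1..n1}. exp (- (\<Sum>t<n. f ((T ^^ t) x))) \<le> u (itinerary n x)" if x: "x \<in> space M" for x
  proof (cases "x \<in> G n1")
    case False
    then have "\<kappa> \<le> f x" unfolding f_def using x c \<eta> L by auto
    then have "exp (- f x) \<le> u (itinerary 1 x)" using \<kappa>(2) by (simp add: u_def flip: \<kappa>(2))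
    then show ?thesis by (intro bexI[of _ 1]) (auto simp: n1_def n0_def)
  next
    case True
    then obtain n where n: "n0 \<le> n" "n \<le> n1" "good n x" by (auto simp: G_def)
    define B where "B = bowen_ball M d T \<delta> n x"
    have B: "B \<in> sets M" unfolding B_def by (rule Bm(1)[OF x])
    define \<rho> where "\<rho> = (\<lambda>z. exp (- (\<eta> + L * indicator K0 z)))"
    have r_ge: "\<rho> z \<le> r (cell z) y" if z: "z \<in> space M" and y: "y \<in> space M" "d z y \<le> \<delta>" for z y
    proof (cases "z \<in> K0")
      case True
      then have "\<rho> z \<le> exp (- L)" using \<eta> by (simp add: \<rho>_def)
      also have "\<dots> \<le> r (cell z) y" unfolding eL r_def by simp
      finally show ?thesis .
    next
      case False
      then obtain A where A: "A \<in> P" "z \<in> K A" using z by (auto simp: K0_def)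
      then have "y \<in> V (cell z)" using near[OF A y] cell_unique[of A z] K(2) by auto
      then show ?thesis using False m \<theta> by (simp add: r_def \<rho>_def)
    qed
    have "(\<Prod>i<n. \<rho> ((T ^^ i) x)) * measure M B = (\<integral>y. (\<Prod>i<n. \<rho> ((T ^^ i) x)) * indicator B y \<partial>M)"
      using B sets.sets_into_space[OF B] by (simp add: Int_absorb2)
    also have "\<dots> \<le> (\<integral>y. (\<Prod>i<n. r (itinerary n x ! i) ((T ^^ i) y)) \<partial>M)"
    proof (rule integral_mono)
      show "integrable M (\<lambda>y. (\<Prod>i<n. \<rho> ((T ^^ i) x)) * indicator B y)"
        using B by (intro integrable_mult_right integrable_real_indicator) (auto simp: emeasure_eq_measure)
      show "integrable M (\<lambda>y. \<Prod>i<n. r (itinerary n x ! i) ((T ^^ i) y))"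
        by (rule prod_int[OF itinerary_words[OF x]])
      fix y assume y: "y \<in> space M"
      show "(\<Prod>i<n. \<rho> ((T ^^ i) x)) * indicator B y \<le> (\<Prod>i<n. r (itinerary n x ! i) ((T ^^ i) y))"
      proof (cases "y \<in> B")
        case True
        then have "(\<Prod>i<n. \<rho> ((T ^^ i) x)) \<le> (\<Prod>i<n. r (itinerary n x ! i) ((T ^^ i) y))"
          using r_ge iterate_space[OF x] iterate_space[OF y]
          by (intro prod_mono) (auto simp: B_def bowen_ball_def itinerary_nth \<rho>_def)
        then show ?thesis using True by simp
      qed (auto intro!: prod_nonneg r_nonneg)
    qed
    finally have int_ge: "(\<Prod>i<n. \<rho> ((T ^^ i) x)) * measure M B
        \<le> (\<integral>y. (\<Prod>i<n. r (itinerary n x ! i) ((T ^^ i) y)) \<partial>M)" .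
    have "exp (- (\<Sum>t<n. f ((T ^^ t) x)))
        \<le> exp (- (\<Sum>t<n. (c + 2 * \<eta>) + L * indicator K0 ((T ^^ t) x)))"
      using \<kappa>(1) by (simp, intro sum_mono) (auto simp: f_def)
    also have "\<dots> = exp (- \<eta>) ^ n * ((\<Prod>i<n. \<rho> ((T ^^ i) x)) * exp (- (c * real n)))"
    proof -
      have "(\<Sum>t<n. (c + 2 * \<eta>) + g t) = real n * \<eta> + ((\<Sum>t<n. \<eta> + g t) + c * real n)" for g :: "nat \<Rightarrow> real"
        by (simp add: sum.distrib algebra_simps)
      then show ?thesis
        unfolding \<rho>_def exp_sum[OF finite_lessThan, symmetric] exp_of_nat_mult[symmetric] exp_add[symmetric] sum_negf
        by simp
    qed
    also have "\<dots> \<le> exp (- \<eta>) ^ n * ((\<Prod>i<n. \<rho> ((T ^^ i) x)) * measure M B)"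
      using n(3) by (intro mult_left_mono) (auto simp: good_def B_def \<rho>_def intro!: prod_nonneg)
    also have "\<dots> \<le> exp (- \<eta>) ^ n * (\<integral>y. (\<Prod>i<n. r (itinerary n x ! i) ((T ^^ i) y)) \<partial>M)"
      by (intro mult_left_mono int_ge) auto
    also have "\<dots> = u (itinerary n x)" using n(1) by (simp add: u_def n0_def)
    finally show ?thesis using n by (intro bexI[of _ n]) (auto simp: n0_def)
  qed
  have "entropy_wrt M T P \<le> (\<integral>x. f x \<partial>M)"
    by (rule entropy_le_mean_block_code_length[of u \<kappa> f n1])
      (use u_nonneg kraft \<kappa> f_int f_nonneg stop in \<open>auto simp: u_def\<close>)
  also have "(\<integral>x. f x \<partial>M) = (c + 2 * \<eta>) + L * measure M K0 + \<kappa> * measure M (space M - G n1)"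
  proof -
    have i: "integrable M (\<lambda>x. L * indicator K0 x :: real)" "integrable M (\<lambda>x. \<kappa> * indicator (space M - G n1) x :: real)"
      by (auto intro!: integrable_mult_right integrable_real_indicator simp: emeasure_eq_measure)
    show ?thesis unfolding f_def using i
      by (simp add: prob_space Int_absorb2 sets.sets_into_space)
  qed
  also have "\<dots> \<le> c + 3 * \<eta> + L * measure M K0" using Gsmall by simp
  finally show ?thesis by (simp add: L_def m_def \<theta>_def K0_def)
qed

end

section \<open>Local decay of Bowen balls in compact metric systems\<close>

lemma (in Metric_space) mball_measurable:
  assumes M: "space N = M" and d: "(\<lambda>(x, y). d x y) \<in> borel_measurable (N \<Otimes>\<^sub>M N)" and x: "x \<in> M"
  shows "mball x r \<in> sets N"
proof -
  have "(\<lambda>y. d x y) \<in> borel_measurable N"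
    using measurable_Pair2[OF d, of x] x M by simp
  then have "{y \<in> space N. d x y < r} \<in> sets N" by measurable
  moreover have "mball x r = {y \<in> space N. d x y < r}" unfolding M using x by (auto simp: mball_def)
  ultimately show ?thesis by simp
qed

text \<open>
  For each \<open>A\<close> this is a Lebesgue number of \<open>K A\<close> for the cover by one open set, the complement of the
  other sets \<open>K B\<close>.
\<close>

lemma (in Metric_space) disjoint_compacts_uniformly_separated:
  assumes P: "finite P" and K: "\<And>A. A \<in> P \<Longrightarrow> compactin mtopology (K A)"
    and disj: "disjoint_family_on K P"
  obtains \<delta> where "0 < \<delta>" "\<And>A B x y. A \<in> P \<Longrightarrow> B \<in> P \<Longrightarrow> A \<noteq> B \<Longrightarrow> x \<in> K A \<Longrightarrow> y \<in> K B \<Longrightarrow> \<delta> \<le> d x y"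
proof -
  have KM: "K A \<subseteq> M" if "A \<in> P" for A using compactin_subset_topspace[OF K[OF that]] by simp
  have "\<exists>e>0. \<forall>x\<in>K A. mball x e \<subseteq> M - (\<Union>B\<in>P - {A}. K B)" if A: "A \<in> P" for A
  proof -
    have "closedin mtopology (\<Union>B\<in>P - {A}. K B)"
      using P K by (intro closedin_Union) (auto intro: compactin_imp_closedin Hausdorff_space_mtopology)
    then have "openin mtopology (M - (\<Union>B\<in>P - {A}. K B))" by (simp add: closedin_def)
    moreover have "K A \<subseteq> M - (\<Union>B\<in>P - {A}. K B)"
      using KM[OF A] disj A by (auto simp: disjoint_family_on_def)
    ultimately have "\<exists>e>0. \<forall>x\<in>K A. \<exists>U\<in>{M - (\<Union>B\<in>P - {A}. K B)}. mball x e \<subseteq> U"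
      by (intro lebesgue_number[OF K[OF A]]) auto
    then show ?thesis by simp
  qed
  then obtain e where e: "\<And>A. A \<in> P \<Longrightarrow> 0 < e A"
      "\<And>A x. A \<in> P \<Longrightarrow> x \<in> K A \<Longrightarrow> mball x (e A) \<subseteq> M - (\<Union>B\<in>P - {A}. K B)"
    by metis
  define \<delta> where "\<delta> = Min (insert 1 (e ` P))"
  show ?thesis
  proof (rule that)
    show "0 < \<delta>" using P e(1) by (simp add: \<delta>_def)
    fix A B x y assume *: "A \<in> P" "B \<in> P" "A \<noteq> B" "x \<in> K A" "y \<in> K B"
    have "y \<notin> mball x (e A)" using e(2)[OF *(1,4)] * by blast
    then have "e A \<le> d x y" using * KM by (auto simp: not_less)
    moreover have "\<delta> \<le> e A" using P * by (simp add: \<delta>_def)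
    ultimately show "\<delta> \<le> d x y" by simp
  qed
qed

text \<open>
  Topological terms in this locale refer to \<open>d\<close>. The Polish topology behind \<open>standard_prob_space\<close>
  enters through the inner regularity of all measurable sets with respect to \<open>d\<close>-compact sets.
\<close>

locale compact_metric_system = measure_preserving_system M T + Metric_space "space M" d
  for M :: "'a measure" and T :: "'a \<Rightarrow> 'a" and d :: "'a \<Rightarrow> 'a \<Rightarrow> real" +
  assumes std: "standard_prob_space M"
    and d_meas: "(\<lambda>(x, y). d x y) \<in> borel_measurable (M \<Otimes>\<^sub>M M)"
    and cpt: "compact_space mtopology"
begin

abbreviation bowen :: "real \<Rightarrow> nat \<Rightarrow> 'a \<Rightarrow> 'a set" where
  "bowen \<delta> n x \<equiv> bowen_ball M d T \<delta> n x"

lemma second_countable: "second_countable mtopology"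
  by (rule compact_space_imp_second_countable[OF cpt])

lemma openin_sets: "openin mtopology U \<Longrightarrow> U \<in> sets M"
  by (rule separable_open_sets_measurable[OF second_countable mball_measurable[OF refl d_meas]])

lemma mball_sets [measurable]: "mball x r \<in> sets M"
  by (rule openin_sets) simp

lemma closedin_sets: "closedin mtopology F \<Longrightarrow> F \<in> sets M"
  by (rule closedin_measurable[OF topspace_mtopology openin_sets])

lemma bowen_graph_sets:
  "{z \<in> space (M \<Otimes>\<^sub>M M). \<forall>t\<in>{..<n}. d ((T ^^ t) (fst z)) ((T ^^ t) (snd z)) \<le> \<delta>} \<in> sets (M \<Otimes>\<^sub>M M)"
proof -
  have "(\<lambda>z. d ((T ^^ t) (fst z)) ((T ^^ t) (snd z))) \<in> borel_measurable (M \<Otimes>\<^sub>M M)" for t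
  proof -
    have "(\<lambda>z. ((T ^^ t) (fst z), (T ^^ t) (snd z))) \<in> measurable (M \<Otimes>\<^sub>M M) (M \<Otimes>\<^sub>M M)"
      by measurable
    from measurable_compose[OF this d_meas] show ?thesis by simp
  qed
  then show ?thesis by measurable
qed

lemma bowen_sets:
  assumes "x \<in> space M"
  shows "bowen \<delta> n x \<in> sets M"
proof -
  have "bowen \<delta> n x = Pair x -` {z \<in> space (M \<Otimes>\<^sub>M M). \<forall>t\<in>{..<n}. d ((T ^^ t) (fst z)) ((T ^^ t) (snd z)) \<le> \<delta>}"
    using assms by (auto simp: bowen_ball_def space_pair_measure)
  then show ?thesis using sets_Pair1[OF bowen_graph_sets] by simp
qed

lemma measure_bowen_measurable: "(\<lambda>x. measure M (bowen \<delta> n x)) \<in> borel_measurable M"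
proof -
  let ?Q = "{z \<in> space (M \<Otimes>\<^sub>M M). \<forall>t\<in>{..<n}. d ((T ^^ t) (fst z)) ((T ^^ t) (snd z)) \<le> \<delta>}"
  have "(\<lambda>x. enn2real (emeasure M (Pair x -` ?Q))) \<in> borel_measurable M"
    using measurable_emeasure_Pair[OF bowen_graph_sets] by measurable
  moreover have "measure M (bowen \<delta> n x) = enn2real (emeasure M (Pair x -` ?Q))" if "x \<in> space M" for x
  proof -
    have "bowen \<delta> n x = Pair x -` ?Q"
      using that by (auto simp: bowen_ball_def space_pair_measure)
    then show ?thesis by (simp add: measure_def)
  qed
  ultimately show ?thesis by (subst measurable_cong) auto
qed

lemma separated_inner_approximation:
  assumes P: "finite_partition M P" and e: "0 < e"
  obtains K V \<delta> where "0 < \<delta>" "\<And>A. A \<in> P \<Longrightarrow> K A \<in> sets M" "\<And>A. A \<in> P \<Longrightarrow> K A \<subseteq> A"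
    "measure M (space M - (\<Union>A\<in>P. K A)) \<le> e"
    "\<And>A. A \<in> P \<Longrightarrow> V A \<in> sets M" "disjoint_family_on V P"
    "\<And>A x y. A \<in> P \<Longrightarrow> x \<in> K A \<Longrightarrow> y \<in> space M \<Longrightarrow> d x y \<le> \<delta> \<Longrightarrow> y \<in> V A"
proof -
  have fin: "finite P" and Ps: "\<And>A. A \<in> P \<Longrightarrow> A \<in> sets M" and PU: "\<Union>P = space M"
      and Pd: "\<And>A B. A \<in> P \<Longrightarrow> B \<in> P \<Longrightarrow> A \<noteq> B \<Longrightarrow> A \<inter> B = {}"
    using P by (auto simp: finite_partition_def partition_on_def disjoint_def)
  have "\<exists>K\<subseteq>A. compactin mtopology K \<and> measure M (A - K) < e / (real (card P) + 1)" if "A \<in> P" for A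
    using e by (intro standard_prob_space_inner_regular_wrt_measurable_topology[OF std
          Hausdorff_space_mtopology second_countable _ openin_sets Ps[OF that]]) auto
  then obtain K where K: "\<And>A. A \<in> P \<Longrightarrow> K A \<subseteq> A" "\<And>A. A \<in> P \<Longrightarrow> compactin mtopology (K A)"
      "\<And>A. A \<in> P \<Longrightarrow> measure M (A - K A) < e / (real (card P) + 1)"
    by metis
  have Ks: "K A \<in> sets M" if "A \<in> P" for A
    using that K(2) by (intro closedin_sets compactin_imp_closedin Hausdorff_space_mtopology)
  have Kd: "disjoint_family_on K P" using K(1) Pd unfolding disjoint_family_on_def by blast
  obtain s where s: "0 < s"
      "\<And>A B x y. A \<in> P \<Longrightarrow> B \<in> P \<Longrightarrow> A \<noteq> B \<Longrightarrow> x \<in> K A \<Longrightarrow> y \<in> K B \<Longrightarrow> s \<le> d x y"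
    by (rule disjoint_compacts_uniformly_separated[OF fin K(2) Kd]) (assumption | rule that)+
  define V where "V = (\<lambda>A. \<Union>x\<in>K A. mball x (s / 2))"
  show ?thesis
  proof (rule that[of "s / 4" K V])
    show "V A \<in> sets M" for A unfolding V_def by (intro openin_sets openin_Union) auto
    show "disjoint_family_on V P"
      unfolding disjoint_family_on_def
    proof (intro ballI impI, rule ccontr)
      fix A B assume AB: "A \<in> P" "B \<in> P" "A \<noteq> B" and "V A \<inter> V B \<noteq> {}"
      then obtain z x y where "x \<in> K A" "y \<in> K B" "z \<in> mball x (s / 2)" "z \<in> mball y (s / 2)"
        unfolding V_def by blast
      then show False using s(2)[OF AB, of x y] triangle[of x z y] commute[of y z] by auto
    qed
    show "y \<in> V A" if "A \<in> P" "x \<in> K A" "y \<in> space M" "d x y \<le> s / 4" for A x y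
    proof -
      have "x \<in> space M" using that(2) sets.sets_into_space[OF Ks[OF that(1)]] by auto
      then show ?thesis using that s(1) by (auto simp: V_def intro!: bexI[of _ x])
    qed
    have "measure M (space M - (\<Union>A\<in>P. K A)) \<le> measure M (\<Union>A\<in>P. A - K A)"
    proof (rule finite_measure_mono)
      show "space M - (\<Union>A\<in>P. K A) \<subseteq> (\<Union>A\<in>P. A - K A)" unfolding PU[symmetric] by blast
    qed (use fin Ps Ks in auto)
    also have "\<dots> \<le> (\<Sum>A\<in>P. measure M (A - K A))"
      using fin Ps Ks by (intro finite_measure_subadditive_finite) auto
    also have "\<dots> \<le> (\<Sum>A\<in>P. e / (real (card P) + 1))"
      using K(3) by (intro sum_mono less_imp_le)
    also have "\<dots> \<le> e" using e by (simp add: field_simps)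
    finally show "measure M (space M - (\<Union>A\<in>P. K A)) \<le> e" .
  qed (use s K Ks in auto)
qed

text \<open>
  The points at which the lower decay rate of Bowen balls is at most \<open>c\<close> in the limit of radius 0. One
  index \<open>j\<close> governs the radius, the excess of the rate over \<open>c\<close> and the least time, so that the
  condition is a countable one. The excess \<open>1 / Suc j\<close> absorbs the shift of time by one step in
  \<open>slow_decay_set_forward_invariant\<close>.
\<close>

definition slow_decay_set :: "real \<Rightarrow> 'a set" where
  "slow_decay_set c = {x \<in> space M. \<forall>j::nat. \<exists>n\<ge>j.
    exp (- ((c + 1 / Suc j) * real n)) \<le> measure M (bowen (1 / Suc j) n x)}"

lemma slow_decay_set_sets: "slow_decay_set c \<in> sets M"
  using measure_bowen_measurable unfolding slow_decay_set_def by measurable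

lemma bowen_mono: "\<delta> \<le> \<delta>' \<Longrightarrow> bowen \<delta> n x \<subseteq> bowen \<delta>' n x"
  by (force simp: bowen_ball_def)

text \<open>
  The order of choices matters: the penalty \<open>L\<close> depends only on \<open>\<eta>\<close> and the number of cells, so the
  compact sets can be chosen after it, and \<open>\<delta>\<close> comes from the compact sets; the decay hypothesis is
  available for every \<open>\<delta>\<close>.
\<close>

lemma entropy_wrt_le_slow_decay_rate:
  assumes c: "0 \<le> c" and E: "AE x in M. x \<in> slow_decay_set c" and P: "finite_partition M P"
  shows "entropy_wrt M T P \<le> c"
proof (rule field_le_epsilon)
  interpret partitioned_system M T P by unfold_locales (rule P)
  fix e :: real assume e: "0 < e"
  define \<eta> where "\<eta> = e / 5"
  define L where "L = ln (real (card P) / (1 - exp (- \<eta>)))"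
  have \<eta>: "0 < \<eta>" using e by (simp add: \<eta>_def)
  have "1 - exp (- \<eta>) \<le> 1" "0 < 1 - exp (- \<eta>)" using \<eta> by auto
  moreover have "1 \<le> real (card P)" using P_nonempty finite_P by (simp add: Suc_leI card_gt_0_iff)
  ultimately have "1 \<le> real (card P) / (1 - exp (- \<eta>))"
    by (subst le_divide_eq_1_pos) linarith+
  then have L: "0 \<le> L" by (simp add: L_def)
  have "0 < \<eta> / (L + 1)" using \<eta> L by simp
  then obtain K V \<delta> where \<delta>: "0 < \<delta>" and K: "\<And>A. A \<in> P \<Longrightarrow> K A \<in> sets M" "\<And>A. A \<in> P \<Longrightarrow> K A \<subseteq> A"
    and K0: "measure M (space M - (\<Union>A\<in>P. K A)) \<le> \<eta> / (L + 1)"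
    and V: "\<And>A. A \<in> P \<Longrightarrow> V A \<in> sets M" "disjoint_family_on V P"
      "\<And>A x y. A \<in> P \<Longrightarrow> x \<in> K A \<Longrightarrow> y \<in> space M \<Longrightarrow> d x y \<le> \<delta> \<Longrightarrow> y \<in> V A"
    by (rule separated_inner_approximation[OF P]) (assumption | rule that)+
  have "entropy_wrt M T P \<le> (c + \<eta>) + 3 * \<eta> + L * measure M (space M - (\<Union>A\<in>P. K A))"
    unfolding L_def
  proof (rule entropy_le_bowen_rate_plus_error[where V = V and d = d and \<delta> = \<delta>])
    fix n0
    obtain j1 where j1: "1 / real (Suc j1) < min \<eta> \<delta>" using \<eta> \<delta> by (metis nat_approx_posE min_less_iff_conj)
    define j where "j = max j1 n0"
    have "1 / real (Suc j) \<le> 1 / real (Suc j1)" by (simp add: j_def frac_le)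
    then have j: "1 / real (Suc j) \<le> \<eta>" "1 / real (Suc j) \<le> \<delta>" "n0 \<le> j" using j1 by (auto simp: j_def)
    show "AE x in M. \<exists>n\<ge>n0. exp (- ((c + \<eta>) * real n)) \<le> measure M (bowen \<delta> n x)"
      using E
    proof eventually_elim
      case (elim x)
      then obtain n where n: "j \<le> n" "exp (- ((c + 1 / Suc j) * real n)) \<le> measure M (bowen (1 / Suc j) n x)"
        and x: "x \<in> space M" by (auto simp: slow_decay_set_def)
      have "exp (- ((c + \<eta>) * real n)) \<le> exp (- ((c + 1 / Suc j) * real n))"
        using j(1) by (simp add: mult_right_mono)
      also note n(2)
      also have "measure M (bowen (1 / Suc j) n x) \<le> measure M (bowen \<delta> n x)"
        using j(2) by (intro finite_measure_mono bowen_mono bowen_sets x)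
      finally show ?case using n(1) j(3) by (intro exI[of _ n]) auto
    qed
  qed (use \<eta> c K V bowen_sets measure_bowen_measurable in auto)
  also have "L * measure M (space M - (\<Union>A\<in>P. K A)) \<le> \<eta>"
  proof -
    have "L * measure M (space M - (\<Union>A\<in>P. K A)) \<le> (L + 1) * (\<eta> / (L + 1))"
      using K0 L by (intro mult_mono) auto
    then show ?thesis using L by simp
  qed
  finally show "entropy_wrt M T P \<le> c + e" by (simp add: \<eta>_def)
qed

text \<open>
  \<open>T\<close> maps \<open>B\<^sub>n(x,\<delta>)\<close> into \<open>B\<^sub>n\<^sub>-\<^sub>1(T x,\<delta>)\<close>, so by invariance of the measure the latter is at least as
  large. The index \<open>i\<close> below is chosen so large that the lost step costs less than the rate gained
  by passing from the excess \<open>s'\<close> to \<open>s\<close>.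
\<close>

lemma slow_decay_set_forward_invariant:
  assumes c: "0 \<le> c" and x: "x \<in> slow_decay_set c"
  shows "T x \<in> slow_decay_set c"
  unfolding slow_decay_set_def
proof (intro CollectI conjI allI)
  have xs: "x \<in> space M" using x by (simp add: slow_decay_set_def)
  show Tx: "T x \<in> space M" using iterate_space[OF xs, of 1] by simp
  fix j :: nat
  define s where "s = 1 / real (Suc j)"
  have s: "0 < s" by (simp add: s_def)
  obtain k :: nat where k: "2 * (c + s) / s < real k" using reals_Archimedean2 by blast
  define i where "i = max (2 * j + 1) k"
  define s' where "s' = 1 / real (Suc i)"
  have ss: "s' \<le> s / 2" unfolding s_def s'_def i_def by (simp add: field_simps)
  obtain n where n: "i \<le> n" "exp (- ((c + s') * real n)) \<le> measure M (bowen s' n x)"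
    using x unfolding slow_decay_set_def s'_def by blast
  have n1: "real (n - 1) = real n - 1" "j \<le> n - 1" using n(1) by (auto simp: i_def)
  have "2 * (c + s) / s \<le> real n" using k n(1) by (simp add: i_def)
  then have "c + s \<le> (s / 2) * real n" using s by (simp add: field_simps)
  also have "\<dots> \<le> (s - s') * real n" using ss by (intro mult_right_mono) auto
  finally have "(c + s') * real n \<le> (c + s) * real (n - 1)" unfolding n1 by (simp add: algebra_simps)
  then have "exp (- ((c + s) * real (n - 1))) \<le> exp (- ((c + s') * real n))" by simp
  also note n(2)
  also have "measure M (bowen s' n x) \<le> measure M (T -` bowen s (n - 1) (T x) \<inter> space M)"
  proof (intro finite_measure_mono measurable_sets[OF T_measurable bowen_sets[OF Tx]])
    have "d ((T ^^ t) (T x)) ((T ^^ t) (T y)) \<le> s" if "t < n - 1" "y \<in> bowen s' n x" for t y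
    proof -
      have "d ((T ^^ Suc t) x) ((T ^^ Suc t) y) \<le> s'"
        using that unfolding bowen_ball_def by (metis (mono_tags, lifting) Suc_eq_plus1 less_diff_conv mem_Collect_eq)
      then show ?thesis using ss s by (simp add: funpow_swap1)
    qed
    then show "bowen s' n x \<subseteq> T -` bowen s (n - 1) (T x) \<inter> space M"
      using iterate_space[of _ 1] by (auto simp: bowen_ball_def)
  qed
  also have "\<dots> = measure M (bowen s (n - 1) (T x))"
    using pres bowen_sets[OF Tx] by (simp add: measure_preserving_def measure_def)
  finally show "\<exists>n\<ge>j. exp (- ((c + 1 / Suc j) * real n)) \<le> measure M (bowen (1 / Suc j) n (T x))"
    using n1(2) unfolding s_def by blast
qed

text \<open>
  The support of \<open>\<mu>\<close> is conull by second countability. At a point outside the support no ball could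
  witness sensitivity, since its own measure is 0.
\<close>

lemma AE_every_ball_positive: "AE x in M. \<forall>r>0. 0 < measure M (mball x r)"
proof -
  obtain \<B> where \<B>: "countable \<B>" "\<And>V. V \<in> \<B> \<Longrightarrow> openin mtopology V"
      "\<And>U x. openin mtopology U \<Longrightarrow> x \<in> U \<Longrightarrow> \<exists>V\<in>\<B>. x \<in> V \<and> V \<subseteq> U"
    using second_countable unfolding second_countable_def by metis
  have "(\<Union>V\<in>{V \<in> \<B>. emeasure M V = 0}. V) \<in> null_sets M"
    using \<B>(1,2) by (intro null_sets_UN') (auto intro!: null_setsI openin_sets)
  then have "AE x in M. x \<notin> (\<Union>V\<in>{V \<in> \<B>. emeasure M V = 0}. V)" by (rule AE_not_in)
  then show ?thesis
  proof (rule AE_mp, intro AE_I2 impI allI)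
    fix x and r :: real assume x: "x \<in> space M" "x \<notin> (\<Union>V\<in>{V \<in> \<B>. emeasure M V = 0}. V)" and r: "0 < r"
    obtain V where V: "V \<in> \<B>" "x \<in> V" "V \<subseteq> mball x r" using \<B>(3)[of "mball x r" x] x(1) r by auto
    then have "measure M V \<noteq> 0" using x(2) by (auto simp: emeasure_eq_measure)
    then have "0 < measure M V" by (simp add: zero_less_measure_iff)
    also have "\<dots> \<le> measure M (mball x r)" by (intro finite_measure_mono V mball_sets)
    finally show "0 < measure M (mball x r)" .
  qed
qed

lemma small_balls_have_small_measure:
  assumes "nonatomic M" "x \<in> space M" "0 < e"
  obtains k where "measure M (mball x (1 / Suc k)) < e"
proof -
  have sing: "{x} \<in> sets M" using assms(2) by (intro closedin_sets) (simp add: closedin_Hausdorff_singleton Hausdorff_space_mtopology)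
  have "measure M {x} = 0"
  proof (rule ccontr)
    assume "measure M {x} \<noteq> 0"
    then have "0 < emeasure M {x}" by (simp add: emeasure_eq_measure zero_less_measure_iff)
    then obtain B where "B \<subseteq> {x}" "0 < emeasure M B" "emeasure M B < emeasure M {x}"
      using assms(1) sing unfolding nonatomic_def by blast
    then show False by (auto simp: subset_singleton_iff)
  qed
  moreover have "(\<Inter>k. mball x (1 / Suc k)) = {x}"
  proof -
    have "y = x" if "y \<in> (\<Inter>k. mball x (1 / Suc k))" for y
    proof (rule ccontr)
      assume "y \<noteq> x"
      have "y \<in> space M" using that by auto
      then have "0 < d x y" using \<open>y \<noteq> x\<close> assms(2) by simp
      then obtain k where "1 / real (Suc k) < d x y" by (metis nat_approx_posE)
      then show False using that by (auto simp: not_less[symmetric] dest!: spec[of _ k])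
    qed
    then show ?thesis using assms(2) by auto
  qed
  moreover have "(\<lambda>k. measure M (mball x (1 / Suc k))) \<longlonglongrightarrow> measure M (\<Inter>k. mball x (1 / Suc k))"
    by (intro finite_Lim_measure_decseq) (auto simp: decseq_def intro!: mball_subset_concentric frac_le simp del: in_mball of_nat_Suc)
  ultimately have "eventually (\<lambda>k. measure M (mball x (1 / Suc k)) < e) sequentially"
    using assms(3) by (intro order_tendstoD) auto
  then show ?thesis using that by (auto simp: eventually_sequentially)
qed

text \<open>
  For \<open>p\<close> the measure of the ball that witnesses insensitivity and \<open>R = - a ln p\<close>, the orbits of almost
  all points of this ball stay \<open>\<delta>\<close>-close to that of \<open>x\<close> at all integer times up to \<open>R\<close>. Hence the Bowen
  ball for \<open>n\<close> steps, \<open>n\<close> the least integer above \<open>R\<close>, has measure at least \<open>p = exp (- R / a)\<close>.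
\<close>

lemma insensitive_imp_slow_decay:
  assumes na: "nonatomic M" and a: "0 < a" and x: "x \<in> space M"
    and pos: "\<And>r. 0 < r \<Longrightarrow> 0 < measure M (mball x r)"
    and ins: "\<And>\<delta>. 0 < \<delta> \<Longrightarrow> \<not> restricted_sensitive_at M d T \<delta> a x"
  shows "x \<in> slow_decay_set (1 / a)"
  unfolding slow_decay_set_def
proof (intro CollectI conjI allI x)
  fix j :: nat
  obtain k where k: "measure M (mball x (1 / Suc k)) < exp (- (real j / a))"
    using small_balls_have_small_measure[OF na x exp_gt_zero] by blast
  \<comment> \<open>Time 0 alone puts the Bowen ball inside a ball of measure below \<open>exp (- j / a)\<close>. This forces
    \<open>R > j\<close>, so that the times \<open>n\<close> obtained in this way are unbounded.\<close>
  define \<delta> where "\<delta> = min (1 / real (Suc j)) (1 / real (Suc k) / 2)"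
  have \<delta>: "0 < \<delta>" "\<delta> \<le> 1 / Suc j" "\<delta> < 1 / Suc k" by (auto simp: \<delta>_def field_simps min_def)
  obtain \<epsilon> where \<epsilon>: "0 < \<epsilon>" and null: "\<And>n. ereal (real n) \<le> ereal a * neg_log (measure M (mball x \<epsilon>)) \<Longrightarrow>
      \<not> 0 < measure M {y \<in> mball x \<epsilon>. \<delta> < d ((T ^^ n) x) ((T ^^ n) y)}"
    using ins[OF \<delta>(1)] unfolding restricted_sensitive_at_def by blast
  define p where "p = measure M (mball x \<epsilon>)"
  have p: "0 < p" "p \<le> 1" using pos[OF \<epsilon>] by (auto simp: p_def)
  define R where "R = - (a * ln p)"
  have R: "0 \<le> R" using p a by (simp add: R_def mult_le_0_iff)
  have nl: "ereal a * neg_log p = ereal R" using p by (simp add: neg_log_def R_def)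
  have pR: "p = exp (- (R / a))" using p a by (simp add: R_def)
  define n where "n = Suc (nat \<lfloor>R\<rfloor>)"
  have n: "R < real n" "\<And>t. t < n \<Longrightarrow> real t \<le> R" using R by (auto simp: n_def less_Suc_eq_le le_nat_floor) linarith+
  have nn: "n \<noteq> 0" by (simp add: n_def)
  define Z where "Z = (\<lambda>t. {y \<in> mball x \<epsilon>. \<delta> < d ((T ^^ t) x) ((T ^^ t) y)})"
  have Zs: "Z t \<in> sets M" for t
  proof -
    have "(\<lambda>y. d ((T ^^ t) x) ((T ^^ t) y)) \<in> borel_measurable M"
      using measurable_compose[OF iterate_measurable measurable_Pair2[OF d_meas iterate_space[OF x]], of t t]
      by simp
    then have "{y \<in> space M. \<delta> < d ((T ^^ t) x) ((T ^^ t) y)} \<in> sets M" by measurable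
    moreover have "Z t = mball x \<epsilon> \<inter> {y \<in> space M. \<delta> < d ((T ^^ t) x) ((T ^^ t) y)}" by (auto simp: Z_def)
    ultimately show ?thesis by auto
  qed
  have "(\<Union>t\<in>{..<n}. Z t) \<in> null_sets M"
  proof (intro null_sets_UN')
    fix t assume "t \<in> {..<n}"
    then have "\<not> 0 < measure M (Z t)"
      using null[of t] n(2)[of t] unfolding Z_def p_def[symmetric] nl by simp
    then show "Z t \<in> null_sets M"
      using Zs by (intro null_setsI) (auto simp: emeasure_eq_measure zero_less_measure_iff)
  qed auto
  then have "p \<le> measure M (mball x \<epsilon> - (\<Union>t\<in>{..<n}. Z t))"
    unfolding p_def by (subst measure_Diff_null_set) auto
  also have "\<dots> \<le> measure M (bowen \<delta> n x)"
    using iterate_space by (intro finite_measure_mono bowen_sets x) (auto simp: Z_def bowen_ball_def not_less)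
  finally have pB: "p \<le> measure M (bowen \<delta> n x)" .
  have "measure M (bowen \<delta> n x) \<le> measure M (mball x (1 / Suc k))"
    using nn \<delta>(3) x by (intro finite_measure_mono mball_sets) (auto simp: bowen_ball_def dest!: spec[of _ 0])
  with pB k have "p < exp (- (real j / a))" by simp
  then have "real j < R" unfolding pR using a by (simp add: field_simps)
  then have jn: "j \<le> n" using n(1) by linarith
  have "R / a \<le> (1 / a + 1 / Suc j) * real n"
  proof -
    have "R / a \<le> real n / a" using n(1) a by (simp add: divide_right_mono)
    also have "\<dots> \<le> (1 / a + 1 / Suc j) * real n" by (simp add: algebra_simps)
    finally show ?thesis .
  qed
  then have "exp (- ((1 / a + 1 / Suc j) * real n)) \<le> p" unfolding pR by simp
  also note pB
  also have "measure M (bowen \<delta> n x) \<le> measure M (bowen (1 / Suc j) n x)"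
    using \<delta>(2) by (intro finite_measure_mono bowen_mono bowen_sets x)
  finally show "\<exists>n\<ge>j. exp (- ((1 / a + 1 / Suc j) * real n)) \<le> measure M (bowen (1 / Suc j) n x)"
    using jn by blast
qed

end

text \<open>
  The preimages of \<open>E\<close> under the iterates increase and all have the measure of \<open>E\<close>. Their union is
  strictly invariant, as ergodicity requires, and has the measure of \<open>E\<close>.
\<close>

lemma (in measure_preserving_system) forward_invariant_zero_one:
  assumes erg: "ergodic M T" and E: "E \<in> sets M" and inv: "\<And>x. x \<in> E \<Longrightarrow> T x \<in> E"
  shows "E \<in> null_sets M \<or> (AE x in M. x \<in> E)"
proof -
  have Es: "E \<subseteq> space M" by (rule sets.sets_into_space[OF E])
  define F where "F = (\<lambda>k. (T ^^ k) -` E \<inter> space M)"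
  have Fs: "F k \<in> sets M" for k unfolding F_def by (rule measurable_sets[OF iterate_measurable E])
  have Fm: "measure M (F k) = measure M E" for k
    using measure_distr[OF iterate_measurable E, of k] by (simp add: distr_iterate F_def)
  have Finc: "F k \<subseteq> F (Suc k)" for k using inv by (auto simp: F_def)
  define U where "U = (\<Union>k. F k)"
  have Us: "U \<in> sets M" unfolding U_def using Fs by auto
  have EU: "E \<subseteq> U" unfolding U_def F_def using Es by (auto intro!: exI[of _ 0])
  have "(\<lambda>k. measure M (F k)) \<longlonglongrightarrow> measure M U"
    unfolding U_def using Fs Finc by (intro finite_Lim_measure_incseq incseq_SucI) auto
  then have mU: "measure M U = measure M E" unfolding Fm using LIMSEQ_unique tendsto_const by blast
  have Tk: "(T ^^ k) (T x) = (T ^^ Suc k) x" for k x by (simp add: funpow_swap1)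
  have "T -` U \<inter> space M = U"
  proof
    show "T -` U \<inter> space M \<subseteq> U"
      unfolding U_def F_def using Tk by (auto, metis)
    show "U \<subseteq> T -` U \<inter> space M"
    proof
      fix x assume "x \<in> U"
      then obtain k where "x \<in> F k" by (auto simp: U_def)
      then have "x \<in> F (Suc k)" using Finc by auto
      then have "x \<in> space M" "(T ^^ k) (T x) \<in> E" unfolding F_def Tk by auto
      moreover have "T x \<in> space M" using iterate_space[OF \<open>x \<in> space M\<close>, of 1] by simp
      ultimately show "x \<in> T -` U \<inter> space M" by (auto simp: U_def F_def)
    qed
  qed
  then have "emeasure M U = 0 \<or> emeasure M (space M - U) = 0" using erg Us unfolding ergodic_def by blast
  then show ?thesis
  proof
    assume "emeasure M U = 0"
    then have "measure M E = 0" using mU by (simp add: measure_def)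
    then show ?thesis using E by (auto simp: emeasure_eq_measure)
  next
    assume "emeasure M (space M - U) = 0"
    then have "measure M E = 1" using mU prob_compl[OF Us] by (simp add: emeasure_eq_measure)
    then show ?thesis using E by (simp add: prob_eq_1)
  qed
qed

section \<open>Positive entropy and restricted sensitivity\<close>

theorem theorem3p3:
  fixes M :: "'a measure" and d :: "'a \<Rightarrow> 'a \<Rightarrow> real" and T :: "'a \<Rightarrow> 'a" and a :: real
  assumes "standard_prob_space M"
    and "Metric_space (space M) d"
    and "(\<lambda>(x, y). d x y) \<in> borel_measurable (M \<Otimes>\<^sub>M M)"
    and "compact_space (Metric_space.mtopology (space M) d)"
    and "nonatomic M"
    and "continuous_map (Metric_space.mtopology (space M) d) (Metric_space.mtopology (space M) d) T"
    and "measure_preserving M T"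
    and "ergodic M T"
    and "a > 0"
    and "metric_entropy M T > ereal (1 / a)"
  shows "restricted_sensitive_with_rate M d T a"
proof -
  interpret compact_metric_system M T d
    using assms by (intro compact_metric_system.intro measure_preserving_system.intro
        measure_preserving_system_axioms.intro compact_metric_system_axioms.intro)
      (auto simp: standard_prob_space_def)
  have c: "0 \<le> 1 / a" using assms(9) by simp
  have "\<not> (AE x in M. x \<in> slow_decay_set (1 / a))"
  proof
    assume E: "AE x in M. x \<in> slow_decay_set (1 / a)"
    have "metric_entropy M T \<le> ereal (1 / a)"
      unfolding metric_entropy_def
      by (intro SUP_least) (auto intro: entropy_wrt_le_slow_decay_rate[OF c E])
    then show False using assms(10) by simp
  qed
  then have "slow_decay_set (1 / a) \<in> null_sets M"
    using forward_invariant_zero_one[OF assms(8) slow_decay_set_sets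
        slow_decay_set_forward_invariant[OF c]] by blast
  then have "AE x in M. x \<notin> slow_decay_set (1 / a)" by (rule AE_not_in)
  with AE_every_ball_positive show ?thesis
    unfolding restricted_sensitive_with_rate_def
  proof (rule AE_mp[OF AE_conjI], intro AE_I2 impI)
    fix x assume "x \<in> space M" and "(\<forall>r>0. 0 < measure M (mball x r)) \<and> x \<notin> slow_decay_set (1 / a)"
    then show "\<exists>\<delta>>0. restricted_sensitive_at M d T \<delta> a x"
      using insensitive_imp_slow_decay[OF assms(5,9)] by blast
  qed
qed

end
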